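(* Fix $u$ and $v$ and assume that there are no redundant actions for the decision-maker. Then for almost all priors $\pi^\circ\in\Delta(\Omega)$ (all except a set of Lebesgue measure zero in the simplex), the following holds for the cheap-talk game $\Gamma(\pi^\circ,u,v)$: if the experts benefit from persuasion, i.e. $\mathrm{cav}\,\overline{u}(\pi^\circ)>\overline{u}(\pi^\circ)$, then the decision-maker benefits from cross-verification, i.e. there exists an equilibrium of $\Gamma(\pi^\circ,u,v)$ in which the decision-maker's payoff is strictly larger than $\max_{a\in A}v(a,\pi^\circ)$.
   Context: Notation. $\Omega$ (states) and $A$ (actions) are finite non-empty sets; $\pi^\circ\in\Delta(\Omega)$ is the common prior; $u,v:A\times\Omega\to\mathbb{R}$ are the payoff functions of the experts (both experts have the same payoff $u$) and of the decision-maker, respectively. $\Delta(X)$ is the set of (discrete) probability distributions on $X$. Payoffs are extended linearly: $u(\alpha,\pi)=\sum_{a,\omega}\alpha(a)\pi(\omega)u(a,\omega)$ for $\alpha\in\Delta(A)$, $\pi\in\Delta(\Omega)$, and likewise $v(\alpha,\pi)$. $BR(\pi)=\{\alpha\in\Delta(A): v(\alpha,\pi)\ge v(\alpha',\pi)\ \forall \alpha'\in\Delta(A)\}$. $\overline{u}(\pi)=\max_{\alpha\in BR(\pi)}u(\alpha,\pi)$, $\overline{v}(\pi)=\max_{\alpha\in\Delta(A)}v(\alpha,\pi)$, and $\mathrm{cav}\,\overline{u}$ is the concavification of $\overline u$, i.e. the smallest concave function on $\Delta(\Omega)$ that is pointwise $\ge\overline{u}$. Non-redundancy. $\hat A=\{a\in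 A:\exists \pi\in\Delta(\Omega)\text{ with }a\in BR(\pi)\}$. There are no redundant actions for the decision-maker if for every non-empty proper subset $B\subsetneq\hat A$ there is $\pi\in\Delta(\Omega)$ with $\overline v(\pi)>\max_{a\in B}v(a,\pi)$. Experiments. A statistical experiment $\sigma$ is a partition of $\Omega\times[0,1]$ into finitely many Lebesgue measurable subsets, called signals. $\Sigma$ is the set of all experiments. The pair $(\omega,x)\in\Omega\times[0,1]$ is drawn from $\pi^\circ\times U[0,1]$, where $U[0,1]$ is uniform; the realized signal of $\sigma$ is the cell $s\in\sigma$ containing $(\omega,x)$. Hence the probability of $(s_1,s_2)\in\sigma_1\times\sigma_2$ conditional on $\omega$ is the Lebesgue measure of $\{x:(\omega,x)\in s_1\cap s_2\}$; in particular if both experts choose the same experiment their signals coincide. Cheap-talk game $\Gamma(\pi^\circ,u,v)$. Stage 1: experts $1,2$ simultaneously choose experiments $\sigma_1,\sigma_2\in\Sigma$, which are publicly observed; then Nature draws $(\omega,x)$. Stage 2: expert $i$ privately observes his signal $s_i\in\sigma_i$ and (simultaneously with the other expert) sends a private message $m_i\in M_i$ to the decision-maker; the message set $M_i$ is rich enough to communicate any signal realization (for every experiment, its signals can be injectively encoded as messages in $M_i$). Stage 3: the decision-maker observes $(\sigma_1,\sigma_2,m_1,m_2)$, but not the signals, and chooses an action. A strategy of expert $i$ is $(\sigma_i,\tau_i)$ with $\sigma_i\in\Sigma$ and $\tau_i(\sigma_i,\sigma_j,s_i)\in\Delta(M_i)$; a strategy of the decision-maker is a map $\alpha$ giving $\alpha(\sigma_1,\sigma_2,m_1,m_2)\in\Delta(A)$.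 Each choice $(\sigma_1,\sigma_2)$ starts a proper sub-game. Equilibrium means weak perfect Bayesian equilibrium with beliefs consistent with the chosen experiments, also off path: for every $(\sigma_1,\sigma_2)$, (i) after each message pair the decision-maker holds a belief $\pi(m_1,m_2)\in\Delta(\Omega)$, given by Bayes' rule in the sub-game if $(m_1,m_2)$ has positive probability in that sub-game, and otherwise an arbitrary average of posteriors conditional on signal pairs $(s_1,s_2)$ of positive probability; (ii) the decision-maker plays a best-reply $\alpha(\sigma_1,\sigma_2,m_1,m_2)\in BR(\pi(m_1,m_2))$; (iii) each expert's message strategy is optimal at each signal of positive probability, given the other strategies; and (iv) at stage 1 no expert gains by choosing another experiment. *)

theory Defs
  imports "HOL-Probability.Probability"
begin

section \<open>States, actions and payoffs\<close>

text \<open>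
  The finite non-empty sets of states and actions are the index types \<open>'w\<close> and \<open>'a\<close>.
  Distributions over them are probability vectors, so that the library notions of convexity
  and concavity apply; distributions over messages (an arbitrary, possibly infinite set)
  are \<open>pmf\<close>s.
\<close>

definition prob_vecs :: "(real ^ 'n::finite) set" where
  "prob_vecs = {p. (\<forall>i. 0 \<le> p $ i) \<and> (\<Sum>i\<in>UNIV. p $ i) = 1}"

abbreviation dirac :: "'n::finite \<Rightarrow> real ^ 'n" where
  "dirac i \<equiv> axis i 1"

type_synonym ('a, 'w) payoff_fun = "'a \<Rightarrow> 'w \<Rightarrow> real"

definition payoff :: "('a::finite, 'w::finite) payoff_fun \<Rightarrow> real ^ 'a \<Rightarrow> real ^ 'w \<Rightarrow> real" where
  "payoff w \<alpha> \<pi> = (\<Sum>a\<in>UNIV. \<Sum>\<omega>\<in>UNIV. \<alpha> $ a * \<pi> $ \<omega> * w a \<omega>)"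

definition BR :: "('a::finite, 'w::finite) payoff_fun \<Rightarrow> real ^ 'w \<Rightarrow> (real ^ 'a) set" where
  "BR v \<pi> = {\<alpha> \<in> prob_vecs. \<forall>\<alpha>'\<in>prob_vecs. payoff v \<alpha> \<pi> \<ge> payoff v \<alpha>' \<pi>}"

text \<open>
  The suprema in the next two definitions are attained, because \<open>prob_vecs\<close> and
  \<open>BR v \<pi>\<close> are compact and non-empty and payoffs are continuous.
\<close>

definition u_bar ::
    "('a::finite, 'w::finite) payoff_fun \<Rightarrow> ('a, 'w) payoff_fun \<Rightarrow> real ^ 'w \<Rightarrow> real" where
  "u_bar u v \<pi> = (SUP \<alpha>\<in>BR v \<pi>. payoff u \<alpha> \<pi>)"

definition v_bar :: "('a::finite, 'w::finite) payoff_fun \<Rightarrow> real ^ 'w \<Rightarrow> real" where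
  "v_bar v \<pi> = (SUP \<alpha>\<in>prob_vecs. payoff v \<alpha> \<pi>)"

definition cav :: "(real ^ 'w::finite \<Rightarrow> real) \<Rightarrow> real ^ 'w \<Rightarrow> real" where
  "cav f \<pi> = Inf {g \<pi> |g. concave_on prob_vecs g \<and> (\<forall>q\<in>prob_vecs. f q \<le> g q)}"

text \<open>For bounded \<open>f\<close>, \<open>cav f\<close> is the smallest concave majorant.\<close>

lemma convex_prob_vecs: "convex (prob_vecs :: (real ^ 'n::finite) set)"
  unfolding convex_def prob_vecs_def
  by (auto simp: sum.distrib simp flip: sum_distrib_left)

lemma cav_least:
  assumes "concave_on prob_vecs g" "\<And>q. q \<in> prob_vecs \<Longrightarrow> f q \<le> g q" "\<pi> \<in> prob_vecs"
  shows "cav f \<pi> \<le> g \<pi>"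
  unfolding cav_def using assms by (intro cInf_lower bdd_belowI[of _ "f \<pi>"]) auto

lemma cav_greatest:
  assumes "\<And>q. q \<in> prob_vecs \<Longrightarrow> f q \<le> B"
    and "\<And>g. concave_on prob_vecs g \<Longrightarrow> (\<And>q. q \<in> prob_vecs \<Longrightarrow> f q \<le> g q) \<Longrightarrow> c \<le> g \<pi>"
  shows "c \<le> cav f \<pi>"
proof -
  have "concave_on prob_vecs (\<lambda>_ :: real ^ 'a. B)"
    by (simp add: concave_on_iff convex_prob_vecs flip: distrib_right)
  then show ?thesis
    unfolding cav_def using assms by (intro cInf_greatest) auto
qed

lemma cav_ge:
  assumes "\<And>q. q \<in> prob_vecs \<Longrightarrow> f q \<le> B" "\<pi> \<in> prob_vecs"
  shows "f \<pi> \<le> cav f \<pi>"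
  using assms by (intro cav_greatest) auto

lemma concave_on_cav:
  assumes "\<And>q. q \<in> prob_vecs \<Longrightarrow> f q \<le> B"
  shows "concave_on prob_vecs (cav f)"
  unfolding concave_on_iff
proof (intro conjI convex_prob_vecs ballI allI impI)
  fix x y :: "real ^ 'a" and s t :: real
  assume xy: "x \<in> prob_vecs" "y \<in> prob_vecs" and st: "0 \<le> s" "0 \<le> t" "s + t = 1"
  show "s * cav f x + t * cav f y \<le> cav f (s *\<^sub>R x + t *\<^sub>R y)"
  proof (rule cav_greatest[OF assms])
    fix g assume g: "concave_on prob_vecs g" "\<And>q. q \<in> prob_vecs \<Longrightarrow> f q \<le> g q"
    have "s * cav f x + t * cav f y \<le> s * g x + t * g y"
      using st xy by (intro add_mono mult_left_mono cav_least g)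
    also have "\<dots> \<le> g (s *\<^sub>R x + t *\<^sub>R y)"
      using g(1) xy st by (auto simp: concave_on_iff)
    finally show "s * cav f x + t * cav f y \<le> g (s *\<^sub>R x + t *\<^sub>R y)" .
  qed
qed

definition rationalizable_actions :: "('a::finite, 'w::finite) payoff_fun \<Rightarrow> 'a set" where
  "rationalizable_actions v = {a. \<exists>\<pi>\<in>prob_vecs. dirac a \<in> BR v \<pi>}"

definition no_redundant_actions :: "('a::finite, 'w::finite) payoff_fun \<Rightarrow> bool" where
  "no_redundant_actions v \<longleftrightarrow>
     (\<forall>B. B \<noteq> {} \<and> B \<subset> rationalizable_actions v \<longrightarrow>
        (\<exists>\<pi>\<in>prob_vecs. v_bar v \<pi> > Max ((\<lambda>a. payoff v (dirac a) \<pi>) ` B)))"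


section \<open>Lebesgue null sets of the simplex\<close>

text \<open>
  Dropping one coordinate \<open>\<omega>0\<close> identifies the simplex with a subset of the Euclidean space
  with coordinates \<open>- {\<omega>0}\<close>, whose Lebesgue measure is the completed product of \<open>lborel\<close>.
  The choice of \<open>\<omega>0\<close> is immaterial, as two such charts differ by an affine map of
  determinant \<open>1\<close> or \<open>-1\<close>. If there is only one state, the simplex is a point of measure one.
\<close>

definition simplex_null :: "(real ^ 'w::finite) set \<Rightarrow> bool" where
  "simplex_null N \<longleftrightarrow> N \<subseteq> prob_vecs \<and>
     (\<forall>\<omega>0. (\<lambda>\<pi>. \<lambda>\<omega>\<in>- {\<omega>0}. \<pi> $ \<omega>) ` N
             \<in> null_sets (completion (\<Pi>\<^sub>M \<omega>\<in>- {\<omega>0}. (lborel :: real measure))))"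

definition for_almost_all_priors :: "(real ^ 'w::finite \<Rightarrow> bool) \<Rightarrow> bool" where
  "for_almost_all_priors P \<longleftrightarrow> simplex_null {\<pi> \<in> prob_vecs. \<not> P \<pi>}"


section \<open>Statistical experiments\<close>

type_synonym 'w signal = "('w \<times> real) set"
type_synonym 'w stat_experiment = "'w signal set"

definition is_experiment :: "'w::finite stat_experiment \<Rightarrow> bool" where
  "is_experiment \<sigma> \<longleftrightarrow>
     finite \<sigma> \<and> partition_on (UNIV \<times> {0..1}) \<sigma> \<and> \<sigma> \<subseteq> sets (count_space UNIV \<Otimes>\<^sub>M lebesgue)"

definition signal_prob :: "'w signal \<Rightarrow> 'w signal \<Rightarrow> 'w \<Rightarrow> real" where
  "signal_prob s1 s2 \<omega> = measure lebesgue {x. (\<omega>, x) \<in> s1 \<inter> s2}"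

definition joint_prob :: "real ^ 'w::finite \<Rightarrow> 'w signal \<Rightarrow> 'w signal \<Rightarrow> 'w \<Rightarrow> real" where
  "joint_prob \<pi>0 s1 s2 \<omega> = \<pi>0 $ \<omega> * signal_prob s1 s2 \<omega>"

definition pair_prob :: "real ^ 'w::finite \<Rightarrow> 'w signal \<Rightarrow> 'w signal \<Rightarrow> real" where
  "pair_prob \<pi>0 s1 s2 = (\<Sum>\<omega>\<in>UNIV. joint_prob \<pi>0 s1 s2 \<omega>)"

definition posterior :: "real ^ 'w::finite \<Rightarrow> 'w signal \<Rightarrow> 'w signal \<Rightarrow> real ^ 'w" where
  "posterior \<pi>0 s1 s2 = (\<chi> \<omega>. joint_prob \<pi>0 s1 s2 \<omega> / pair_prob \<pi>0 s1 s2)"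


section \<open>The cheap-talk game\<close>

text \<open>
  The message sets are the types \<open>'m1\<close> and \<open>'m2\<close>. The first argument of \<open>report1\<close> and
  \<open>report2\<close> is the expert's own experiment, the second one that of the other expert;
  \<open>decision\<close> and \<open>belief\<close> always take the experiment and message of expert 1 first.
\<close>

record ('w, 'a, 'm1, 'm2) assessment =
  exper1 :: "'w stat_experiment"
  exper2 :: "'w stat_experiment"
  report1 :: "'w stat_experiment \<Rightarrow> 'w stat_experiment \<Rightarrow> 'w signal \<Rightarrow> 'm1 pmf"
  report2 :: "'w stat_experiment \<Rightarrow> 'w stat_experiment \<Rightarrow> 'w signal \<Rightarrow> 'm2 pmf"
  decision :: "'w stat_experiment \<Rightarrow> 'w stat_experiment \<Rightarrow> 'm1 \<Rightarrow> 'm2 \<Rightarrow> real ^ 'a"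
  belief :: "'w stat_experiment \<Rightarrow> 'w stat_experiment \<Rightarrow> 'm1 \<Rightarrow> 'm2 \<Rightarrow> real ^ 'w"

text \<open>
  Expected value of the payoff on the event that the realized signals lie in
  \<open>S1\<close> and \<open>S2\<close>; not conditional on that event.
\<close>

definition expected_payoff ::
  "('a::finite, 'w::finite) payoff_fun \<Rightarrow> real ^ 'w \<Rightarrow> 'w signal set \<Rightarrow> 'w signal set \<Rightarrow>
   ('w signal \<Rightarrow> 'm1 pmf) \<Rightarrow> ('w signal \<Rightarrow> 'm2 pmf) \<Rightarrow> ('m1 \<Rightarrow> 'm2 \<Rightarrow> real ^ 'a) \<Rightarrow> real" where
  "expected_payoff w \<pi>0 S1 S2 t1 t2 d =
     (\<Sum>\<omega>\<in>UNIV. \<Sum>s1\<in>S1. \<Sum>s2\<in>S2. joint_prob \<pi>0 s1 s2 \<omega> *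
        measure_pmf.expectation (pair_pmf (t1 s1) (t2 s2))
          (\<lambda>(m1, m2). payoff w (d m1 m2) (dirac \<omega>)))"

definition subgame_payoff ::
  "('a::finite, 'w::finite) payoff_fun \<Rightarrow> real ^ 'w \<Rightarrow> ('w, 'a, 'm1, 'm2) assessment \<Rightarrow>
   'w stat_experiment \<Rightarrow> 'w stat_experiment \<Rightarrow> real" where
  "subgame_payoff w \<pi>0 E \<sigma>1 \<sigma>2 =
     expected_payoff w \<pi>0 \<sigma>1 \<sigma>2 (report1 E \<sigma>1 \<sigma>2) (report2 E \<sigma>2 \<sigma>1) (decision E \<sigma>1 \<sigma>2)"

definition eq_payoff ::
  "('a::finite, 'w::finite) payoff_fun \<Rightarrow> real ^ 'w \<Rightarrow> ('w, 'a, 'm1, 'm2) assessment \<Rightarrow> real" where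
  "eq_payoff w \<pi>0 E = subgame_payoff w \<pi>0 E (exper1 E) (exper2 E)"

definition message_joint_prob ::
  "real ^ 'w::finite \<Rightarrow> ('w, 'a::finite, 'm1, 'm2) assessment \<Rightarrow>
   'w stat_experiment \<Rightarrow> 'w stat_experiment \<Rightarrow> 'm1 \<Rightarrow> 'm2 \<Rightarrow> 'w \<Rightarrow> real" where
  "message_joint_prob \<pi>0 E \<sigma>1 \<sigma>2 m1 m2 \<omega> =
     (\<Sum>s1\<in>\<sigma>1. \<Sum>s2\<in>\<sigma>2. joint_prob \<pi>0 s1 s2 \<omega> *
        pmf (report1 E \<sigma>1 \<sigma>2 s1) m1 * pmf (report2 E \<sigma>2 \<sigma>1 s2) m2)"

definition message_prob ::
  "real ^ 'w::finite \<Rightarrow> ('w, 'a::finite, 'm1, 'm2) assessment \<Rightarrow>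
   'w stat_experiment \<Rightarrow> 'w stat_experiment \<Rightarrow> 'm1 \<Rightarrow> 'm2 \<Rightarrow> real" where
  "message_prob \<pi>0 E \<sigma>1 \<sigma>2 m1 m2 = (\<Sum>\<omega>\<in>UNIV. message_joint_prob \<pi>0 E \<sigma>1 \<sigma>2 m1 m2 \<omega>)"

definition consistent_beliefs ::
  "real ^ 'w::finite \<Rightarrow> ('w, 'a::finite, 'm1, 'm2) assessment \<Rightarrow>
   'w stat_experiment \<Rightarrow> 'w stat_experiment \<Rightarrow> bool" where
  "consistent_beliefs \<pi>0 E \<sigma>1 \<sigma>2 \<longleftrightarrow>
     (\<forall>m1 m2.
        if message_prob \<pi>0 E \<sigma>1 \<sigma>2 m1 m2 > 0
        then belief E \<sigma>1 \<sigma>2 m1 m2 =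
               (\<chi> \<omega>. message_joint_prob \<pi>0 E \<sigma>1 \<sigma>2 m1 m2 \<omega> / message_prob \<pi>0 E \<sigma>1 \<sigma>2 m1 m2)
        else belief E \<sigma>1 \<sigma>2 m1 m2 \<in>
               convex hull {posterior \<pi>0 s1 s2 |s1 s2.
                              s1 \<in> \<sigma>1 \<and> s2 \<in> \<sigma>2 \<and> pair_prob \<pi>0 s1 s2 > 0})"

definition sequentially_rational_decision ::
  "('a::finite, 'w::finite) payoff_fun \<Rightarrow> ('w, 'a, 'm1, 'm2) assessment \<Rightarrow>
   'w stat_experiment \<Rightarrow> 'w stat_experiment \<Rightarrow> bool" where
  "sequentially_rational_decision v E \<sigma>1 \<sigma>2 \<longleftrightarrow>
     (\<forall>m1 m2. decision E \<sigma>1 \<sigma>2 m1 m2 \<in> BR v (belief E \<sigma>1 \<sigma>2 m1 m2))"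

definition own_signal_prob :: "real ^ 'w::finite \<Rightarrow> 'w signal \<Rightarrow> real" where
  "own_signal_prob \<pi>0 s = (\<Sum>\<omega>\<in>UNIV. \<pi>0 $ \<omega> * measure lebesgue {x. (\<omega>, x) \<in> s})"

definition optimal_report1 ::
  "('a::finite, 'w::finite) payoff_fun \<Rightarrow> real ^ 'w \<Rightarrow> ('w, 'a, 'm1, 'm2) assessment \<Rightarrow>
   'w stat_experiment \<Rightarrow> 'w stat_experiment \<Rightarrow> bool" where
  "optimal_report1 u \<pi>0 E \<sigma>1 \<sigma>2 \<longleftrightarrow>
     (\<forall>s1\<in>\<sigma>1. own_signal_prob \<pi>0 s1 > 0 \<longrightarrow>
        (let U = \<lambda>p. expected_payoff u \<pi>0 {s1} \<sigma>2 (\<lambda>_. p) (report2 E \<sigma>2 \<sigma>1) (decision E \<sigma>1 \<sigma>2)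
                     / own_signal_prob \<pi>0 s1
         in \<forall>p. U p \<le> U (report1 E \<sigma>1 \<sigma>2 s1)))"

definition optimal_report2 ::
  "('a::finite, 'w::finite) payoff_fun \<Rightarrow> real ^ 'w \<Rightarrow> ('w, 'a, 'm1, 'm2) assessment \<Rightarrow>
   'w stat_experiment \<Rightarrow> 'w stat_experiment \<Rightarrow> bool" where
  "optimal_report2 u \<pi>0 E \<sigma>1 \<sigma>2 \<longleftrightarrow>
     (\<forall>s2\<in>\<sigma>2. own_signal_prob \<pi>0 s2 > 0 \<longrightarrow>
        (let U = \<lambda>p. expected_payoff u \<pi>0 \<sigma>1 {s2} (report1 E \<sigma>1 \<sigma>2) (\<lambda>_. p) (decision E \<sigma>1 \<sigma>2)
                     / own_signal_prob \<pi>0 s2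
         in \<forall>p. U p \<le> U (report2 E \<sigma>2 \<sigma>1 s2)))"

definition equilibrium ::
  "('a::finite, 'w::finite) payoff_fun \<Rightarrow> ('a, 'w) payoff_fun \<Rightarrow> real ^ 'w \<Rightarrow>
   ('w, 'a, 'm1, 'm2) assessment \<Rightarrow> bool" where
  "equilibrium u v \<pi>0 E \<longleftrightarrow>
     is_experiment (exper1 E) \<and> is_experiment (exper2 E) \<and>
     (\<forall>\<sigma>1 \<sigma>2. is_experiment \<sigma>1 \<and> is_experiment \<sigma>2 \<longrightarrow>
        consistent_beliefs \<pi>0 E \<sigma>1 \<sigma>2 \<and>
        sequentially_rational_decision v E \<sigma>1 \<sigma>2 \<and>
        optimal_report1 u \<pi>0 E \<sigma>1 \<sigma>2 \<and>
        optimal_report2 u \<pi>0 E \<sigma>1 \<sigma>2) \<and>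
     (\<forall>\<sigma>. is_experiment \<sigma> \<longrightarrow> subgame_payoff u \<pi>0 E \<sigma> (exper2 E) \<le> eq_payoff u \<pi>0 E) \<and>
     (\<forall>\<sigma>. is_experiment \<sigma> \<longrightarrow> subgame_payoff u \<pi>0 E (exper1 E) \<sigma> \<le> eq_payoff u \<pi>0 E)"

end

theory Submission
  imports Defs
begin

text \<open>
  Both experts choose the same experiment and report truthfully. If their messages disagree,
  the decision-maker picks a best reply that leaves neither of the two possible deviators
  better off than truth-telling would; if one of them has chosen another experiment, play
  reverts to babbling. For such a common experiment to be an equilibrium, it only has to give
  the experts at least their babbling payoff and to admit punishments after every mismatch.

  For a generic prior one action \<open>a0\<close> is strictly optimal and the prior is interior. Take an
  experiment that attains the concavification. Since it cannot be improved by pooling two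
  posteriors at an intermediate belief, punishments exist by a connectedness argument on the
  segment between these posteriors. The decision-maker gains unless \<open>a0\<close> is still optimal at
  every posterior. In that case the experts gain at some belief on the boundary of the region
  of \<open>a0\<close>, and, as no action is redundant, sending a posterior slightly across that boundary
  with small probability benefits everyone, while \<open>a0\<close> itself is the punishment.
\<close>

section \<open>Best replies\<close>

lemma prob_vecs_nonneg: "p \<in> prob_vecs \<Longrightarrow> 0 \<le> p $ i"
  and prob_vecs_sum: "p \<in> prob_vecs \<Longrightarrow> (\<Sum>i\<in>UNIV. p $ i) = 1"
  by (auto simp: prob_vecs_def)

lemma prob_vecs_le_1:
  assumes "p \<in> prob_vecs"
  shows "p $ i \<le> 1"
  using member_le_sum[of i UNIV "\<lambda>i. p $ i"] assms by (simp add: prob_vecs_def)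

lemma dirac_in_prob_vecs: "dirac i \<in> prob_vecs"
  by (auto simp: prob_vecs_def axis_def)

lemma compact_prob_vecs: "compact (prob_vecs :: (real ^ 'n::finite) set)"
proof -
  have "closed (prob_vecs :: (real ^ 'n) set)"
    unfolding prob_vecs_def
    by (intro closed_Collect_conj closed_Collect_all closed_Collect_le closed_Collect_eq
        continuous_intros)
  moreover have "prob_vecs \<subseteq> cbox 0 (\<chi> i::'n. 1)"
    by (auto simp: mem_box_cart prob_vecs_nonneg prob_vecs_le_1)
  ultimately show ?thesis
    by (metis bounded_cbox bounded_subset compact_eq_bounded_closed)
qed

lemma payoff_add_left: "payoff w (\<alpha> + \<beta>) \<pi> = payoff w \<alpha> \<pi> + payoff w \<beta> \<pi>"
  by (simp add: payoff_def algebra_simps sum.distrib)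

lemma payoff_scaleR_left: "payoff w (c *\<^sub>R \<alpha>) \<pi> = c * payoff w \<alpha> \<pi>"
  by (simp add: payoff_def algebra_simps sum_distrib_left)

lemma payoff_add_right: "payoff w \<alpha> (\<pi> + \<rho>) = payoff w \<alpha> \<pi> + payoff w \<alpha> \<rho>"
  by (simp add: payoff_def algebra_simps sum.distrib)

lemma payoff_scaleR_right: "payoff w \<alpha> (c *\<^sub>R \<pi>) = c * payoff w \<alpha> \<pi>"
  by (simp add: payoff_def algebra_simps sum_distrib_left)

lemma payoff_sum_right: "payoff w \<alpha> (\<Sum>i\<in>I. c i *\<^sub>R p i) = (\<Sum>i\<in>I. c i * payoff w \<alpha> (p i))"
proof (induction I rule: infinite_finite_induct)
  case (insert i I)
  then show ?case by (simp add: payoff_add_right payoff_scaleR_right)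
qed (simp_all add: payoff_def)

lemma payoff_eq_sum_dirac_right:
  "payoff w \<alpha> \<pi> = (\<Sum>\<omega>\<in>UNIV. \<pi> $ \<omega> * payoff w \<alpha> (dirac \<omega>))"
  unfolding payoff_def axis_def
  by (subst sum.swap) (simp add: sum_distrib_left mult_ac if_distrib if_distribR cong: if_cong)

lemma payoff_eq_sum_dirac_left:
  "payoff w \<alpha> \<pi> = (\<Sum>a\<in>UNIV. \<alpha> $ a * payoff w (dirac a) \<pi>)"
proof -
  have "payoff w (dirac a) \<pi> = (\<Sum>\<omega>\<in>UNIV. \<pi> $ \<omega> * w a \<omega>)" for a
    unfolding payoff_def axis_def by (subst sum.swap) (simp add: if_distrib if_distribR cong: if_cong)
  then show ?thesis
    by (simp add: payoff_def sum_distrib_left mult_ac)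
qed

lemma continuous_on_payoff [continuous_intros]:
  assumes "continuous_on S f" "continuous_on S g"
  shows "continuous_on S (\<lambda>x. payoff w (f x) (g x))"
  unfolding payoff_def by (intro continuous_intros assms)

lemma payoff_le_dirac:
  assumes "\<alpha> \<in> prob_vecs" "\<And>a. \<alpha> $ a > 0 \<Longrightarrow> payoff w (dirac a) \<pi> \<le> c"
  shows "payoff w \<alpha> \<pi> \<le> c"
proof -
  have "payoff w \<alpha> \<pi> \<le> (\<Sum>a\<in>UNIV. \<alpha> $ a * c)"
    unfolding payoff_eq_sum_dirac_left[of w \<alpha>]
    using assms prob_vecs_nonneg[OF assms(1)]
    by (intro sum_mono) (metis less_eq_real_def mult_eq_0_iff mult_left_mono)
  then show ?thesis
    using assms(1) by (simp add: prob_vecs_sum flip: sum_distrib_right)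
qed

section \<open>The best-reply correspondence\<close>

lemma BR_subset: "BR v \<pi> \<subseteq> prob_vecs"
  by (auto simp: BR_def)

text \<open>By linearity a mixture earns at most what its best pure action earns, so testing pure
  deviations is enough.\<close>

lemma BR_iff:
  "\<alpha> \<in> BR v \<pi> \<longleftrightarrow> \<alpha> \<in> prob_vecs \<and> (\<forall>a. payoff v (dirac a) \<pi> \<le> payoff v \<alpha> \<pi>)"
  unfolding BR_def by (auto simp: dirac_in_prob_vecs intro: payoff_le_dirac)

lemma BR_ge: "\<alpha> \<in> BR v \<pi> \<Longrightarrow> \<beta> \<in> prob_vecs \<Longrightarrow> payoff v \<beta> \<pi> \<le> payoff v \<alpha> \<pi>"
  by (auto simp: BR_def)

lemma ex_dirac_BR: "\<exists>a. dirac a \<in> BR v \<pi>"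
proof -
  let ?f = "\<lambda>a. payoff v (dirac a) \<pi>"
  have "Max (range ?f) \<in> range ?f"
    by (intro Max_in) auto
  then obtain a where a: "Max (range ?f) = ?f a"
    by blast
  have "?f b \<le> ?f a" for b
    unfolding a[symmetric] by (intro Max_ge) auto
  then show ?thesis
    unfolding BR_iff by (blast intro: dirac_in_prob_vecs)
qed

lemma convex_BR: "convex (BR v \<pi>)"
proof (rule convexI)
  fix x y :: "real ^ 'a" and s t :: real
  assume xy: "x \<in> BR v \<pi>" "y \<in> BR v \<pi>" and st: "0 \<le> s" "0 \<le> t" "s + t = 1"
  have "s *\<^sub>R x + t *\<^sub>R y \<in> prob_vecs"
    using xy st BR_subset by (blast intro: convexD[OF convex_prob_vecs])
  moreover have "payoff v \<beta> \<pi> \<le> payoff v (s *\<^sub>R x + t *\<^sub>R y) \<pi>" if "\<beta> \<in> prob_vecs" for \<beta>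
  proof -
    have "payoff v \<beta> \<pi> = s * payoff v \<beta> \<pi> + t * payoff v \<beta> \<pi>"
      using st by (simp flip: distrib_right)
    also have "\<dots> \<le> s * payoff v x \<pi> + t * payoff v y \<pi>"
      using xy st that by (intro add_mono mult_left_mono BR_ge) auto
    finally show ?thesis
      by (simp add: payoff_add_left payoff_scaleR_left)
  qed
  ultimately show "s *\<^sub>R x + t *\<^sub>R y \<in> BR v \<pi>"
    by (simp add: BR_def)
qed

text \<open>With the pure-deviation test the graph is cut out by finitely many weak inequalities
  between continuous functions. This is the upper hemicontinuity of best replies.\<close>

lemma closed_BR_graph: "closed {(\<pi>, \<alpha>). \<alpha> \<in> BR v \<pi>}"
proof -
  have "{(\<pi>, \<alpha>). \<alpha> \<in> BR v \<pi>}
      = {x. snd x \<in> prob_vecs} \<inter> {x. \<forall>a. payoff v (dirac a) (fst x) \<le> payoff v (snd x) (fst x)}"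
    by (auto simp: BR_iff)
  also have "closed \<dots>"
    by (intro closed_Int closed_Collect_all closed_Collect_le continuous_intros
        closed_vimage[of prob_vecs snd, unfolded vimage_def] compact_imp_closed compact_prob_vecs)
  finally show ?thesis .
qed

lemma compact_BR_graph: "compact {(\<pi>, \<alpha>). \<pi> \<in> prob_vecs \<and> \<alpha> \<in> BR v \<pi>}"
proof -
  have "{(\<pi>, \<alpha>). \<pi> \<in> prob_vecs \<and> \<alpha> \<in> BR v \<pi>}
      = (prob_vecs \<times> prob_vecs) \<inter> {(\<pi>, \<alpha>). \<alpha> \<in> BR v \<pi>}"
    using BR_subset by blast
  also have "compact \<dots>"
    by (intro compact_Int_closed compact_Times compact_prob_vecs closed_BR_graph)
  finally show ?thesis .
qed

lemma compact_BR: "compact (BR v \<pi>)"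
proof -
  have "BR v \<pi> = prob_vecs \<inter> (\<lambda>\<alpha>. (\<pi>, \<alpha>)) -` {(\<pi>, \<alpha>). \<alpha> \<in> BR v \<pi>}"
    using BR_subset by auto
  also have "compact \<dots>"
    by (intro compact_Int_closed compact_prob_vecs closed_vimage closed_BR_graph continuous_intros)
  finally show ?thesis .
qed

lemma u_bar_ge: "\<alpha> \<in> BR v \<pi> \<Longrightarrow> payoff u \<alpha> \<pi> \<le> u_bar u v \<pi>"
  unfolding u_bar_def
  by (intro cSUP_upper bounded_imp_bdd_above compact_imp_bounded compact_continuous_image
      compact_BR continuous_intros)

lemma u_bar_attained: "\<exists>\<alpha>\<in>BR v \<pi>. u_bar u v \<pi> = payoff u \<alpha> \<pi>"
proof -
  have "\<exists>\<alpha>\<in>BR v \<pi>. \<forall>\<beta>\<in>BR v \<pi>. payoff u \<beta> \<pi> \<le> payoff u \<alpha> \<pi>"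
    using ex_dirac_BR[of v \<pi>]
    by (intro continuous_attains_sup compact_BR continuous_intros) auto
  then obtain \<alpha> where \<alpha>: "\<alpha> \<in> BR v \<pi>" "\<And>\<beta>. \<beta> \<in> BR v \<pi> \<Longrightarrow> payoff u \<beta> \<pi> \<le> payoff u \<alpha> \<pi>"
    by blast
  then have "u_bar u v \<pi> \<le> payoff u \<alpha> \<pi>"
    unfolding u_bar_def by (intro cSUP_least) auto
  with \<alpha>(1) show ?thesis
    by (meson antisym u_bar_ge)
qed

text \<open>Positive weight on a strictly worse action would pull the average over the support
  strictly below the optimal value.\<close>

lemma dirac_in_BR_if_support:
  assumes "\<alpha> \<in> BR v \<pi>" "\<alpha> $ a > 0"
  shows "dirac a \<in> BR v \<pi>"
proof (rule ccontr)
  have \<alpha>: "\<alpha> \<in> prob_vecs" using assms(1) BR_subset by blast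
  let ?c = "payoff v \<alpha> \<pi>"
  have le: "payoff v (dirac b) \<pi> \<le> ?c" for b
    using assms(1) by (simp add: BR_iff)
  assume "dirac a \<notin> BR v \<pi>"
  then obtain b where "\<not> payoff v (dirac b) \<pi> \<le> payoff v (dirac a) \<pi>"
    by (auto simp: BR_iff dirac_in_prob_vecs)
  with le[of b] have "payoff v (dirac a) \<pi> < ?c"
    by linarith
  then have "(\<Sum>b\<in>UNIV. \<alpha> $ b * payoff v (dirac b) \<pi>) < (\<Sum>b\<in>UNIV. \<alpha> $ b * ?c)"
    using \<alpha> le assms(2)
    by (intro sum_strict_mono_ex1 ballI bexI[of _ a] mult_left_mono mult_strict_left_mono)
      (simp_all add: prob_vecs_nonneg)
  then show False
    using \<alpha> by (simp add: prob_vecs_sum flip: sum_distrib_right payoff_eq_sum_dirac_left)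
qed

text \<open>Some action in the support of an optimal mixture earns the experts at least as much as
  the mixture, and it is itself a best reply. A pure maximizer is needed because non-redundancy
  speaks about actions.\<close>

lemma u_bar_attained_dirac: "\<exists>a. dirac a \<in> BR v \<pi> \<and> u_bar u v \<pi> = payoff u (dirac a) \<pi>"
proof (rule ccontr)
  assume none: "\<nexists>a. dirac a \<in> BR v \<pi> \<and> u_bar u v \<pi> = payoff u (dirac a) \<pi>"
  obtain \<alpha> where \<alpha>: "\<alpha> \<in> BR v \<pi>" "u_bar u v \<pi> = payoff u \<alpha> \<pi>"
    using u_bar_attained by blast
  let ?A = "{a. dirac a \<in> BR v \<pi>}"
  define c where "c = Max ((\<lambda>a. payoff u (dirac a) \<pi>) ` ?A)"
  have "?A \<noteq> {}" using ex_dirac_BR by auto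
  then have "c \<in> (\<lambda>a. payoff u (dirac a) \<pi>) ` ?A"
    unfolding c_def by (intro Max_in) auto
  then have "c < u_bar u v \<pi>"
    using none u_bar_ge by (force simp: less_le)
  moreover have "payoff u \<alpha> \<pi> \<le> c"
  proof (rule payoff_le_dirac)
    show "\<alpha> \<in> prob_vecs"
      using \<alpha>(1) BR_subset by blast
    show "payoff u (dirac a) \<pi> \<le> c" if "\<alpha> $ a > 0" for a
      unfolding c_def using dirac_in_BR_if_support[OF \<alpha>(1) that] by (intro Max_ge) auto
  qed
  ultimately show False using \<alpha>(2) by simp
qed

section \<open>Values and non-redundant actions\<close>

lemma v_bar_eq:
  assumes "\<alpha> \<in> BR v \<pi>"
  shows "v_bar v \<pi> = payoff v \<alpha> \<pi>"
proof -
  have "(prob_vecs :: (real ^ 'a) set) \<noteq> {}"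
    using dirac_in_prob_vecs by blast
  then have "v_bar v \<pi> \<le> payoff v \<alpha> \<pi>"
    unfolding v_bar_def by (rule cSUP_least) (rule BR_ge[OF assms])
  moreover have "payoff v \<alpha> \<pi> \<le> v_bar v \<pi>"
    unfolding v_bar_def
  proof (rule cSUP_upper)
    show "\<alpha> \<in> prob_vecs"
      using assms BR_subset by blast
    show "bdd_above ((\<lambda>\<alpha>. payoff v \<alpha> \<pi>) ` prob_vecs)"
      by (intro bounded_imp_bdd_above compact_imp_bounded compact_continuous_image
          compact_prob_vecs continuous_intros)
  qed
  ultimately show ?thesis by simp
qed

text \<open>Without \<open>a\<close> the remaining rationalizable actions fall short of
  \<open>v_bar\<close> at some belief. The best reply there is rationalizable, so it can only be
  \<open>a\<close>, and every other rationalizable action, in particular \<open>b\<close>, is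
  strictly worse.\<close>

lemma ex_separating_belief:
  assumes "no_redundant_actions v" "a \<in> rationalizable_actions v" "b \<in> rationalizable_actions v"
    and "a \<noteq> b"
  shows "\<exists>\<pi>\<in>prob_vecs. dirac a \<in> BR v \<pi> \<and> payoff v (dirac b) \<pi> < payoff v (dirac a) \<pi>"
proof -
  let ?B = "rationalizable_actions v - {a}"
  have "?B \<noteq> {} \<and> ?B \<subset> rationalizable_actions v"
    using assms(2-4) by blast
  then have "\<exists>\<pi>\<in>prob_vecs. v_bar v \<pi> > Max ((\<lambda>a. payoff v (dirac a) \<pi>) ` ?B)"
    using assms(1)[unfolded no_redundant_actions_def, THEN spec, of ?B] by (rule rev_mp)
  then obtain \<pi> where \<pi>: "\<pi> \<in> prob_vecs" "v_bar v \<pi> > Max ((\<lambda>a. payoff v (dirac a) \<pi>) ` ?B)"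
    by (rule bexE)
  obtain c where c: "dirac c \<in> BR v \<pi>" using ex_dirac_BR by blast
  have less: "payoff v (dirac d) \<pi> < payoff v (dirac c) \<pi>" if "d \<in> ?B" for d
  proof -
    have "payoff v (dirac d) \<pi> \<le> Max ((\<lambda>a. payoff v (dirac a) \<pi>) ` ?B)"
      using that by (intro Max_ge) auto
    with \<pi>(2) show ?thesis
      by (simp add: v_bar_eq[OF c])
  qed
  have "c \<in> rationalizable_actions v"
    unfolding rationalizable_actions_def using c \<pi>(1) by blast
  with less[of c] have "c = a"
    by fast
  then show ?thesis
    using less[of b] c \<pi>(1) assms(3,4) by blast
qed

text \<open>Each expression tends to \<open>A f\<close> as \<epsilon> decreases to 0, and finitely
  many eventual conditions hold simultaneously. This supplies perturbations small enough to preserve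
  strict inequalities.\<close>

lemma ex_small_positive:
  fixes A B :: "'i \<Rightarrow> real"
  assumes "finite F" "\<And>f. f \<in> F \<Longrightarrow> A f > 0"
  shows "\<exists>\<epsilon>. 0 < \<epsilon> \<and> \<epsilon> < 1 \<and> (\<forall>f\<in>F. A f + \<epsilon> * B f > 0)"
proof -
  have "\<forall>\<^sub>F \<epsilon> in at_right 0. A f + \<epsilon> * B f > 0" if "f \<in> F" for f
  proof (rule order_tendstoD)
    show "((\<lambda>\<epsilon>. A f + \<epsilon> * B f) \<longlongrightarrow> A f + 0 * B f) (at_right 0)"
      by (intro tendsto_add tendsto_mult tendsto_const tendsto_ident_at)
  qed (use assms that in auto)
  then have "\<forall>\<^sub>F \<epsilon> in at_right 0. \<forall>f\<in>F. A f + \<epsilon> * B f > 0"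
    using assms(1) by (simp add: eventually_ball_finite)
  moreover have "\<forall>\<^sub>F \<epsilon> in at_right (0::real). \<epsilon> \<in> {0<..<1}"
    by (rule eventually_at_right_real) simp
  ultimately have "\<forall>\<^sub>F \<epsilon> in at_right 0. \<epsilon> \<in> {0<..<1} \<and> (\<forall>f\<in>F. A f + \<epsilon> * B f > 0)"
    by eventually_elim simp
  then have "\<exists>\<epsilon>. \<epsilon> \<in> {0<..<1} \<and> (\<forall>f\<in>F. A f + \<epsilon> * B f > 0)"
    by (rule eventually_happens'[rotated]) simp
  then show ?thesis
    by (simp add: conj_assoc)
qed

section \<open>Null sets of the simplex\<close>

text \<open>Fubini: when all coordinates except one with a nonzero coefficient are fixed, the
  equation leaves at most one value for that coordinate. If all coefficients vanish, then
  \<open>c\<close> does not and the set is empty.\<close>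

lemma affine_hyperplane_null_PiM:
  fixes d :: "'i \<Rightarrow> real" and c :: real
  assumes I: "finite I" and nz: "c \<noteq> 0 \<or> (\<exists>i\<in>I. d i \<noteq> 0)"
  shows "{x \<in> extensional I. c + (\<Sum>i\<in>I. d i * x i) = 0} \<in> null_sets (\<Pi>\<^sub>M i\<in>I. lborel)"
proof (cases "\<exists>i\<in>I. d i \<noteq> 0")
  case False
  then show ?thesis using nz by simp
next
  case True
  then obtain i where i: "i \<in> I" "d i \<noteq> 0" by blast
  interpret product_sigma_finite "\<lambda>_::'i. lborel :: real measure" by standard
  let ?J = "I - {i}"
  let ?M = "\<Pi>\<^sub>M i\<in>I. (lborel :: real measure)"
  define H where "H = {x \<in> space ?M. c + (\<Sum>i\<in>I. d i * x i) = 0}"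
  have H: "H \<in> sets ?M"
    unfolding H_def by measurable
  have "emeasure ?M H = (\<integral>\<^sup>+x. indicator H x \<partial>?M)"
    using H by simp
  also have "\<dots> = (\<integral>\<^sup>+x. (\<integral>\<^sup>+y. indicator H (x(i := y)) \<partial>lborel) \<partial>(\<Pi>\<^sub>M i\<in>?J. lborel))"
    using product_nn_integral_insert[of ?J i "indicator H"] H I i(1) by (simp add: insert_absorb)
  also have "\<dots> = (\<integral>\<^sup>+x. 0 \<partial>(\<Pi>\<^sub>M i\<in>?J. (lborel :: real measure)))"
  proof (intro nn_integral_cong)
    fix x :: "'i \<Rightarrow> real"
    define y0 where "y0 = - (c + (\<Sum>j\<in>?J. d j * x j)) / d i"
    have "y = y0" if "x(i := y) \<in> H" for y
    proof -
      have "(\<Sum>j\<in>I. d j * (x(i := y)) j) = d i * y + (\<Sum>j\<in>?J. d j * x j)"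
        by (subst sum.remove[OF I i(1)]) simp
      then show ?thesis
        using that i(2) by (simp add: H_def y0_def field_simps)
    qed
    then have "(\<integral>\<^sup>+y. indicator H (x(i := y)) \<partial>lborel) \<le> (\<integral>\<^sup>+y. indicator {y0} y \<partial>lborel)"
      by (intro nn_integral_mono) (auto simp: indicator_def)
    then show "(\<integral>\<^sup>+y. indicator H (x(i := y)) \<partial>lborel) = 0"
      by simp
  qed
  finally have "H \<in> null_sets ?M"
    using H by (simp add: null_sets_def)
  then show ?thesis
    by (simp add: H_def space_PiM PiE_def)
qed

text \<open>In the chart that drops \<omega>0, substituting \<open>\<pi> $ \<omega>0\<close> by one
  minus the other coordinates turns the homogeneous equation into an affine one. Its coefficients
  \<open>l \<omega> - l \<omega>0\<close> and its constant \<open>l \<omega>0\<close> cannot all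
  vanish.\<close>

lemma simplex_null_hyperplane:
  fixes l :: "'w::finite \<Rightarrow> real"
  assumes nz: "\<exists>\<omega>. l \<omega> \<noteq> 0"
  shows "simplex_null {\<pi> \<in> prob_vecs. (\<Sum>\<omega>\<in>UNIV. l \<omega> * \<pi> $ \<omega>) = 0}"
  unfolding simplex_null_def
proof (intro conjI allI)
  fix \<omega>0 :: 'w
  let ?I = "- {\<omega>0}"
  let ?N = "{\<pi> \<in> prob_vecs. (\<Sum>\<omega>\<in>UNIV. l \<omega> * \<pi> $ \<omega>) = 0}"
  let ?H = "{x \<in> extensional ?I. l \<omega>0 + (\<Sum>\<omega>\<in>?I. (l \<omega> - l \<omega>0) * x \<omega>) = 0}"
  have "?H \<in> null_sets (\<Pi>\<^sub>M \<omega>\<in>?I. lborel)"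
  proof (rule affine_hyperplane_null_PiM)
    show "l \<omega>0 \<noteq> 0 \<or> (\<exists>\<omega>\<in>?I. l \<omega> - l \<omega>0 \<noteq> 0)"
      using nz by (cases "l \<omega>0 = 0") auto
  qed simp
  moreover have "(\<lambda>\<pi>. \<lambda>\<omega>\<in>?I. \<pi> $ \<omega>) ` ?N \<subseteq> ?H"
  proof safe
    fix \<pi> :: "real ^ 'w"
    assume \<pi>: "\<pi> \<in> prob_vecs" and 0: "(\<Sum>\<omega>\<in>UNIV. l \<omega> * \<pi> $ \<omega>) = 0"
    have split: "(\<Sum>\<omega>\<in>UNIV. f \<omega>) = f \<omega>0 + (\<Sum>\<omega>\<in>?I. f \<omega>)" for f :: "'w \<Rightarrow> real"
      by (simp add: sum.remove[of UNIV \<omega>0] Compl_eq_Diff_UNIV)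
    have "\<pi> $ \<omega>0 = 1 - (\<Sum>\<omega>\<in>?I. \<pi> $ \<omega>)"
      using prob_vecs_sum[OF \<pi>] by (simp add: split)
    with 0 show "l \<omega>0 + (\<Sum>\<omega>\<in>?I. (l \<omega> - l \<omega>0) * (\<lambda>\<omega>\<in>?I. \<pi> $ \<omega>) \<omega>) = 0"
      by (simp add: split algebra_simps sum_subtractf sum_distrib_left)
  qed simp
  ultimately show "(\<lambda>\<pi>. \<lambda>\<omega>\<in>?I. \<pi> $ \<omega>) ` ?N
      \<in> null_sets (completion (\<Pi>\<^sub>M \<omega>\<in>?I. lborel))"
    by (blast intro: null_sets_completionI null_sets_completion_subset)
qed auto

lemma simplex_null_UN:
  assumes "finite F" "\<And>f. f \<in> F \<Longrightarrow> simplex_null (N f)"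
  shows "simplex_null (\<Union>f\<in>F. N f)"
  unfolding simplex_null_def
proof (intro conjI allI)
  show "(\<Union>f\<in>F. N f) \<subseteq> prob_vecs"
    using assms(2) by (auto simp: simplex_null_def)
  show "(\<lambda>\<pi>. \<lambda>\<omega>\<in>- {\<omega>0}. \<pi> $ \<omega>) ` (\<Union>f\<in>F. N f)
      \<in> null_sets (completion (\<Pi>\<^sub>M \<omega>\<in>- {\<omega>0}. lborel))" for \<omega>0
    unfolding image_UN using assms
    by (intro null_sets_UN' countable_finite) (simp_all add: simplex_null_def)
qed

lemma simplex_null_subset:
  assumes "simplex_null N" "M \<subseteq> N"
  shows "simplex_null M"
  unfolding simplex_null_def
proof (intro conjI allI)
  show "M \<subseteq> prob_vecs"
    using assms by (auto simp: simplex_null_def)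
  show "(\<lambda>\<pi>. \<lambda>\<omega>\<in>- {\<omega>0}. \<pi> $ \<omega>) ` M
      \<in> null_sets (completion (\<Pi>\<^sub>M \<omega>\<in>- {\<omega>0}. lborel))" for \<omega>0
    by (rule null_sets_completion_subset[OF image_mono[OF assms(2)]])
      (use assms(1) in \<open>simp add: simplex_null_def\<close>)
qed

section \<open>Experiments\<close>

lemma signal_prob_commute: "signal_prob s1 s2 \<omega> = signal_prob s2 s1 \<omega>"
  by (simp add: signal_prob_def Int_commute)

lemma joint_prob_commute: "joint_prob \<pi>0 s1 s2 \<omega> = joint_prob \<pi>0 s2 s1 \<omega>"
  by (simp add: joint_prob_def signal_prob_commute)

lemma joint_prob_nonneg: "\<pi>0 \<in> prob_vecs \<Longrightarrow> 0 \<le> joint_prob \<pi>0 s1 s2 \<omega>"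
  by (simp add: joint_prob_def signal_prob_def prob_vecs_nonneg)

lemma experiment_section:
  assumes "is_experiment \<sigma>" "s \<in> \<sigma>"
  shows "Pair \<omega> -` s \<in> lmeasurable" "Pair \<omega> -` s \<subseteq> {0..1}"
proof -
  show sub: "Pair \<omega> -` s \<subseteq> {0..1}"
    using assms by (auto simp: is_experiment_def partition_on_def)
  have "Pair \<omega> -` s \<in> sets lebesgue"
    using assms by (intro sets_Pair1[of s "count_space UNIV"]) (auto simp: is_experiment_def)
  with sub show "Pair \<omega> -` s \<in> lmeasurable"
    by (meson bounded_closed_interval bounded_subset bounded_set_imp_lmeasurable)
qed

text \<open>Applied first with \<open>T\<close> a section of a signal of the other experiment and
  then with the whole interval, this sums probabilities over all signal pairs.\<close>

lemma sum_measure_sections: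
  assumes \<sigma>: "is_experiment \<sigma>" and T: "T \<in> lmeasurable" "T \<subseteq> {0..1}"
  shows "(\<Sum>s\<in>\<sigma>. measure lebesgue (T \<inter> Pair \<omega> -` s)) = measure lebesgue T"
proof -
  have part: "finite \<sigma>" "\<Union>\<sigma> = UNIV \<times> {0..1}" "disjoint \<sigma>"
    using \<sigma> by (auto simp: is_experiment_def partition_on_def)
  have lm: "T \<inter> Pair \<omega> -` s \<in> lmeasurable" if "s \<in> \<sigma>" for s
    using T(1) experiment_section(1)[OF \<sigma> that] by (rule fmeasurable.Int)
  have "(\<Sum>s\<in>\<sigma>. measure lebesgue (T \<inter> Pair \<omega> -` s))
      = measure lebesgue (\<Union>s\<in>\<sigma>. T \<inter> Pair \<omega> -` s)"
  proof (rule measure_finite_Union[symmetric])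
    show "disjoint_family_on (\<lambda>s. T \<inter> Pair \<omega> -` s) \<sigma>"
      using part(3) by (auto simp: disjoint_family_on_def disjoint_def)
    show "(\<lambda>s. T \<inter> Pair \<omega> -` s) ` \<sigma> \<subseteq> sets lebesgue"
      using lm by (blast intro: fmeasurableD)
    show "emeasure lebesgue (T \<inter> Pair \<omega> -` s) \<noteq> \<infinity>" if "s \<in> \<sigma>" for s
      using fmeasurableD2[OF lm[OF that]] by simp
  qed (fact part(1))
  also have "(\<Union>s\<in>\<sigma>. T \<inter> Pair \<omega> -` s) = T \<inter> Pair \<omega> -` \<Union>\<sigma>"
    by blast
  also have "\<dots> = T"
    using T(2) by (auto simp: part(2))
  finally show ?thesis .
qed

lemma sum_joint_prob:
  assumes "is_experiment \<sigma>1" "is_experiment \<sigma>2"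
  shows "(\<Sum>s1\<in>\<sigma>1. \<Sum>s2\<in>\<sigma>2. joint_prob \<pi>0 s1 s2 \<omega>) = \<pi>0 $ \<omega>"
proof -
  have "(\<Sum>s2\<in>\<sigma>2. signal_prob s1 s2 \<omega>) = measure lebesgue ({0..1} \<inter> Pair \<omega> -` s1)"
    if "s1 \<in> \<sigma>1" for s1
  proof -
    have "signal_prob s1 s2 \<omega> = measure lebesgue (Pair \<omega> -` s1 \<inter> Pair \<omega> -` s2)" for s2
      by (simp add: signal_prob_def vimage_def flip: Collect_conj_eq)
    moreover have "{0..1} \<inter> Pair \<omega> -` s1 = Pair \<omega> -` s1"
      using experiment_section(2)[OF assms(1) that] by blast
    ultimately show ?thesis
      using experiment_section[OF assms(1) that] by (simp add: sum_measure_sections[OF assms(2)])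
  qed
  then have "(\<Sum>s1\<in>\<sigma>1. \<Sum>s2\<in>\<sigma>2. signal_prob s1 s2 \<omega>) = measure lebesgue {0..1::real}"
    by (simp add: sum_measure_sections[OF assms(1)])
  then show ?thesis
    by (simp add: joint_prob_def flip: sum_distrib_left)
qed

text \<open>In each state the unit interval is cut into consecutive intervals of lengths
  \<open>l i \<omega>\<close>, and the cell of \<open>i\<close> collects its interval from every
  state. The partial sums \<open>c k \<omega>\<close> are the cut points.\<close>

lemma ex_experiment:
  fixes l :: "'i \<Rightarrow> 'w::finite \<Rightarrow> real"
  assumes I: "finite I" and nonneg: "\<And>i \<omega>. i \<in> I \<Longrightarrow> 0 \<le> l i \<omega>"
    and sum_1: "\<And>\<omega>. (\<Sum>i\<in>I. l i \<omega>) = 1"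
    and pos: "\<And>i. i \<in> I \<Longrightarrow> \<exists>\<omega>. 0 < l i \<omega>"
  obtains cell where "inj_on cell I" "is_experiment (cell ` I)"
    "\<And>i j \<omega>. i \<in> I \<Longrightarrow> j \<in> I \<Longrightarrow> signal_prob (cell i) (cell j) \<omega> = (if i = j then l i \<omega> else 0)"
proof -
  obtain h and n :: nat where h: "bij_betw h {0..<n} I"
    using ex_bij_betw_nat_finite[OF I] by blast
  define c where "c k \<omega> = (\<Sum>j<k. l (h j) \<omega>)" for k \<omega>
  \<comment> \<open>The half-open intervals miss the point 1. It is given to the first cell, which
    changes no measure.\<close>
  define T where "T k \<omega> = {c k \<omega>..<c (Suc k) \<omega>} \<union> (if k = 0 then {1} else {})" for k \<omega>
  define C where "C k = {(\<omega>, x). x \<in> T k \<omega>}" for k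
  have I_eq: "I = h ` {0..<n}"
    using h by (simp add: bij_betw_def)
  have hI: "h k \<in> I" if "k < n" for k
    unfolding I_eq using that by simp
  have c_0: "c 0 \<omega> = 0" for \<omega>
    by (simp add: c_def)
  have c_n: "c n \<omega> = 1" for \<omega>
    using sum.reindex_bij_betw[OF h, of "\<lambda>i. l i \<omega>"] sum_1[of \<omega>]
    by (simp add: c_def atLeast0LessThan)
  have c_mono: "c k \<omega> \<le> c k' \<omega>" if "k \<le> k'" "k' \<le> n" for k k' \<omega>
    unfolding c_def using that by (intro sum_mono2) (auto intro!: nonneg hI)
  have T_sub: "T k \<omega> \<subseteq> {0..1}" if "k < n" for k \<omega>
    using c_mono[of 0 k \<omega>] c_mono[of "Suc k" n \<omega>] that by (auto simp: T_def c_0 c_n)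
  have T_disj: "T k \<omega> \<inter> T k' \<omega> = {}" if "k < k'" "k' < n" for k k' \<omega>
    using c_mono[of "Suc k" k' \<omega>] c_mono[of "Suc k'" n \<omega>] that by (auto simp: T_def c_n)
  have T_cover: "\<exists>k<n. x \<in> T k \<omega>" if x: "x \<in> {0..1}" for x \<omega>
  proof (cases "x = 1")
    case True
    have "n \<noteq> 0" using c_0[of \<omega>] c_n[of \<omega>] by (intro notI) simp
    with True show ?thesis by (auto simp: T_def)
  next
    case False
    then have x_less: "x < c n \<omega>" using x by (simp add: c_n)
    \<comment> \<open>The first cut point beyond \<open>x\<close> is the right end of the interval
      that contains \<open>x\<close>, so the cell index is the predecessor of
      \<open>K\<close>.\<close>
    define K where "K = (LEAST k. x < c k \<omega>)"
    have K: "x < c K \<omega>" "K \<le> n"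
      unfolding K_def
      using LeastI[of "\<lambda>k. x < c k \<omega>", OF x_less] Least_le[of "\<lambda>k. x < c k \<omega>", OF x_less]
      by blast+
    with x have "K \<noteq> 0" by (intro notI) (simp add: c_0)
    then obtain k where k: "K = Suc k" by (cases K) auto
    have "\<not> x < c k \<omega>"
      by (rule not_less_Least[of k "\<lambda>k. x < c k \<omega>"]) (use k in \<open>simp add: K_def\<close>)
    with K have "x \<in> T k \<omega>" "k < n"
      by (simp_all add: T_def k)
    then show ?thesis by blast
  qed
  have null_1: "{1::real} \<in> null_sets lebesgue"
    by (simp add: null_sets_completionI)
  have T_measure: "measure lebesgue (T k \<omega>) = l (h k) \<omega>" if "k < n" for k \<omega>
  proof -
    have "measure lebesgue (T k \<omega>) = measure lebesgue {c k \<omega>..<c (Suc k) \<omega>}"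
      unfolding T_def using null_1 by (simp add: measure_Un_null_set)
    also have "\<dots> = l (h k) \<omega>"
      using nonneg[OF hI[OF that], of \<omega>] by (simp add: c_def)
    finally show ?thesis .
  qed
  have T_sets: "T k \<omega> \<in> sets lebesgue" for k \<omega>
    by (simp add: T_def)
  \<comment> \<open>Cells of a partition must be non-empty; together with disjointness this also
    makes \<open>cell\<close> injective.\<close>
  have C_ne: "C k \<noteq> {}" if "k < n" for k
  proof -
    obtain \<omega> where "0 < l (h k) \<omega>" using pos hI \<open>k < n\<close> by blast
    then have "T k \<omega> \<noteq> {}" using T_measure[OF that, of \<omega>] by (intro notI) simp
    then show ?thesis by (auto simp: C_def)
  qed
  have C_disj: "C k \<inter> C k' = {}" if "k \<noteq> k'" "k < n" "k' < n" for k k'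
  proof -
    have "T k \<omega> \<inter> T k' \<omega> = {}" for \<omega>
      using that T_disj[of k k' \<omega>] T_disj[of k' k \<omega>] by (cases k k' rule: linorder_cases) auto
    then show ?thesis by (auto simp: C_def)
  qed
  have C_sets: "C k \<in> sets (count_space UNIV \<Otimes>\<^sub>M lebesgue)" for k
  proof -
    have "C k = (\<Union>\<omega>\<in>UNIV. {\<omega>} \<times> T k \<omega>)" by (auto simp: C_def)
    also have "\<dots> \<in> sets (count_space UNIV \<Otimes>\<^sub>M lebesgue)"
      using T_sets by (intro sets.finite_UN pair_measureI) auto
    finally show ?thesis .
  qed
  define cell where "cell i = C (the_inv_into {0..<n} h i)" for i
  have cell_h: "cell (h k) = C k" if "k < n" for k
    using h that by (simp add: cell_def bij_betw_def the_inv_into_f_f)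
  have cell_image: "cell ` I = C ` {0..<n}"
    unfolding I_eq image_image using cell_h by (intro image_cong) auto
  have "partition_on (UNIV \<times> {0..1}) (C ` {0..<n})"
  proof (rule partition_onI)
    have C_sub: "C k \<subseteq> UNIV \<times> {0..1}" if "k < n" for k
      using T_sub[OF that] by (auto simp: C_def)
    have C_cover: "(\<omega>, x) \<in> \<Union> (C ` {0..<n})" if "x \<in> {0..1}" for \<omega> x
      using T_cover[OF that, of \<omega>] by (simp add: C_def Bex_def)
    show "\<Union> (C ` {0..<n}) = UNIV \<times> {0..1}"
    proof (rule equalityI)
      show "\<Union> (C ` {0..<n}) \<subseteq> UNIV \<times> {0..1}"
        by (intro UN_least C_sub) simp
      show "UNIV \<times> {0..1} \<subseteq> \<Union> (C ` {0..<n})"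
        using C_cover by (intro subsetI) (elim SigmaE, blast)
    qed
    show "disjnt p q" if pq: "p \<in> C ` {0..<n}" "q \<in> C ` {0..<n}" "p \<noteq> q" for p q
    proof -
      obtain k k' where "p = C k" "q = C k'" "k \<in> {0..<n}" "k' \<in> {0..<n}"
        using pq(1,2) by blast
      with C_disj[of k k'] pq(3) show ?thesis
        by (cases "k = k'") (simp_all add: disjnt_def)
    qed
    show "{} \<notin> C ` {0..<n}"
      using C_ne by fastforce
  qed
  then have exp: "is_experiment (cell ` I)"
    unfolding is_experiment_def cell_image using C_sets by auto
  have inj: "inj_on cell I"
  proof (rule inj_onI)
    fix i j assume "i \<in> I" "j \<in> I" and eq: "cell i = cell j"
    then obtain k k' where k: "i = h k" "j = h k'" "k < n" "k' < n"
      unfolding I_eq by fastforce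
    with eq have "C k = C k'" by (simp add: cell_h)
    with C_disj[of k k'] C_ne[of k] k show "i = j" by auto
  qed
  show thesis
  proof (rule that[OF inj exp])
    fix i j \<omega> assume "i \<in> I" "j \<in> I"
    then obtain k k' where k: "i = h k" "j = h k'" "k < n" "k' < n"
      unfolding I_eq by fastforce
    have ij: "i = j \<longleftrightarrow> k = k'"
      using k h by (auto simp: bij_betw_def inj_on_eq_iff)
    have cells: "cell i = C k" "cell j = C k'"
      using k by (simp_all add: cell_h)
    have "signal_prob (C k) (C k') \<omega> = (if k = k' then l (h k) \<omega> else 0)"
    proof (cases "k = k'")
      case True
      then have "signal_prob (C k) (C k') \<omega> = measure lebesgue (T k \<omega>)"
        by (simp add: signal_prob_def C_def)
      with True k(3) show ?thesis
        by (simp add: T_measure)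
    next
      case False
      then have "C k \<inter> C k' = {}" using k(3,4) by (rule C_disj)
      with False show ?thesis
        by (simp add: signal_prob_def)
    qed
    then show "signal_prob (cell i) (cell j) \<omega> = (if i = j then l i \<omega> else 0)"
      by (simp only: cells ij) (simp only: k(1))
  qed
qed

section \<open>Expected payoffs and babbling\<close>

lemma expected_payoff_swap:
  "expected_payoff W \<pi>0 S1 S2 t1 t2 d = expected_payoff W \<pi>0 S2 S1 t2 t1 (\<lambda>m2 m1. d m1 m2)"
proof -
  have "measure_pmf.expectation (pair_pmf (t1 s1) (t2 s2)) (\<lambda>(m1, m2). payoff W (d m1 m2) (dirac \<omega>))
      = measure_pmf.expectation (pair_pmf (t2 s2) (t1 s1)) (\<lambda>(m2, m1). payoff W (d m1 m2) (dirac \<omega>))"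
    for s1 s2 \<omega>
    by (subst pair_commute_pmf) (simp add: split_def)
  then show ?thesis
    unfolding expected_payoff_def
    by (subst sum.swap[of _ S2 S1]) (simp add: joint_prob_commute)
qed

lemma expected_payoff_sum_signals:
  "expected_payoff W \<pi>0 S1 S2 t1 t2 d = (\<Sum>s1\<in>S1. expected_payoff W \<pi>0 {s1} S2 (\<lambda>_. t1 s1) t2 d)"
  unfolding expected_payoff_def by (subst sum.swap) simp

lemma expected_payoff_const_decision:
  "expected_payoff W \<pi>0 S1 S2 t1 t2 (\<lambda>_ _. \<alpha>)
    = (\<Sum>\<omega>\<in>UNIV. (\<Sum>s1\<in>S1. \<Sum>s2\<in>S2. joint_prob \<pi>0 s1 s2 \<omega>) * payoff W \<alpha> (dirac \<omega>))"
  unfolding expected_payoff_def by (simp add: sum_distrib_right split_def)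

lemma expected_payoff_babbling:
  assumes "is_experiment \<sigma>1" "is_experiment \<sigma>2"
  shows "expected_payoff W \<pi>0 \<sigma>1 \<sigma>2 t1 t2 (\<lambda>_ _. \<alpha>) = payoff W \<alpha> \<pi>0"
  unfolding expected_payoff_const_decision sum_joint_prob[OF assms]
  by (rule payoff_eq_sum_dirac_right[symmetric])

text \<open>Posteriors average to the prior, with the pair probabilities as weights. Hence the prior
  is an admissible belief after any message pair of probability zero.\<close>

lemma prior_in_hull_posteriors:
  assumes \<sigma>: "is_experiment \<sigma>1" "is_experiment \<sigma>2" and \<pi>0: "\<pi>0 \<in> prob_vecs"
  shows "\<pi>0 \<in> convex hull {posterior \<pi>0 s1 s2 |s1 s2.
           s1 \<in> \<sigma>1 \<and> s2 \<in> \<sigma>2 \<and> pair_prob \<pi>0 s1 s2 > 0}" (is "_ \<in> convex hull ?P")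
proof -
  let ?pair = "\<lambda>x. pair_prob \<pi>0 (fst x) (snd x)"
  let ?joint = "\<lambda>x. joint_prob \<pi>0 (fst x) (snd x)"
  let ?X = "{x \<in> \<sigma>1 \<times> \<sigma>2. ?pair x > 0}"
  have fin: "finite (\<sigma>1 \<times> \<sigma>2)"
    using \<sigma> by (simp add: is_experiment_def)
  have joint_nonneg: "0 \<le> ?joint x \<omega>" for x \<omega>
    by (rule joint_prob_nonneg[OF \<pi>0])
  \<comment> \<open>The terms of a vanishing sum of nonnegative numbers vanish, so restricting to
    pairs of positive probability loses no mass in any state.\<close>
  have zero: "?joint x \<omega> = 0" if "x \<in> \<sigma>1 \<times> \<sigma>2 - ?X" for x \<omega>
  proof -
    have "?pair x = 0"
      using that joint_nonneg sum_nonneg[of UNIV "?joint x"] by (force simp: pair_prob_def not_less)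
    then show ?thesis
      using joint_nonneg by (simp add: pair_prob_def sum_nonneg_eq_0_iff)
  qed
  have sum_X: "(\<Sum>x\<in>?X. ?joint x \<omega>) = \<pi>0 $ \<omega>" for \<omega>
  proof -
    have "(\<Sum>x\<in>?X. ?joint x \<omega>) = (\<Sum>x\<in>\<sigma>1 \<times> \<sigma>2. ?joint x \<omega>)"
      using fin zero by (intro sum.mono_neutral_left) auto
    also have "\<dots> = \<pi>0 $ \<omega>"
      using sum_joint_prob[OF \<sigma>, of \<pi>0 \<omega>] by (simp add: sum.cartesian_product case_prod_beta)
    finally show ?thesis .
  qed
  have "(\<Sum>x\<in>?X. ?pair x *\<^sub>R posterior \<pi>0 (fst x) (snd x)) \<in> convex hull ?P"
  proof (rule convex_sum)
    show "finite ?X" using fin by simp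
    have "(\<Sum>x\<in>?X. ?pair x) = (\<Sum>\<omega>\<in>UNIV. \<pi>0 $ \<omega>)"
      unfolding pair_prob_def by (subst sum.swap) (simp add: sum_X flip: pair_prob_def)
    then show "(\<Sum>x\<in>?X. ?pair x) = 1"
      using \<pi>0 by (simp add: prob_vecs_sum)
    show "posterior \<pi>0 (fst x) (snd x) \<in> convex hull ?P" if "x \<in> ?X" for x
      using that by (intro hull_inc) force
  qed (simp_all add: convex_convex_hull less_imp_le)
  also have "(\<Sum>x\<in>?X. ?pair x *\<^sub>R posterior \<pi>0 (fst x) (snd x)) = \<pi>0"
  proof (rule vec_eq_iff[THEN iffD2, rule_format])
    fix \<omega>
    have "(\<Sum>x\<in>?X. ?pair x *\<^sub>R posterior \<pi>0 (fst x) (snd x)) $ \<omega> = (\<Sum>x\<in>?X. ?joint x \<omega>)"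
      by (simp add: posterior_def)
    then show "(\<Sum>x\<in>?X. ?pair x *\<^sub>R posterior \<pi>0 (fst x) (snd x)) $ \<omega> = \<pi>0 $ \<omega>"
      by (simp add: sum_X)
  qed
  finally show ?thesis .
qed

section \<open>Truthful reports in a common experiment\<close>

lemma ex_decoder:
  assumes "inj_on f I" "i0 \<in> I"
  obtains g where "\<And>i. i \<in> I \<Longrightarrow> g (f i) = i" "\<And>m. g m \<in> I"
proof
  \<comment> \<open>A message that encodes no signal is read as the default index \<open>i0\<close>.
    Every message is then equivalent to some report in \<open>I\<close>, and only deviations to
    other indices remain to be deterred.\<close>
  let ?g = "\<lambda>m. if m \<in> f ` I then the_inv_into I f m else i0"
  show "?g (f i) = i" if "i \<in> I" for i
    using assms that by (simp add: the_inv_into_f_f)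
  show "?g m \<in> I" for m
    using assms by (auto simp: the_inv_into_f_f)
qed

text \<open>Both experts run the same experiment, so two different cells never occur together. The
  diagonal joint probabilities say that cell \<open>i\<close> has probability \<open>w i\<close> and
  posterior \<open>p i\<close>.\<close>

locale splitting_experiment =
  fixes \<pi>0 :: "real ^ 'w::finite" and I :: "'i set" and w :: "'i \<Rightarrow> real"
    and p :: "'i \<Rightarrow> real ^ 'w" and cell :: "'i \<Rightarrow> 'w signal"
  assumes finite_I: "finite I"
    and w_pos: "i \<in> I \<Longrightarrow> 0 < w i"
    and p_prob: "i \<in> I \<Longrightarrow> p i \<in> prob_vecs"
    and inj_cell: "inj_on cell I"
    and joint_prob_cell: "i \<in> I \<Longrightarrow> j \<in> I \<Longrightarrow>
      joint_prob \<pi>0 (cell i) (cell j) \<omega> = (if i = j then w i * p i $ \<omega> else 0)"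
begin

lemma pair_prob_cell: "i \<in> I \<Longrightarrow> pair_prob \<pi>0 (cell i) (cell i) = w i"
  by (simp add: pair_prob_def joint_prob_cell prob_vecs_sum p_prob flip: sum_distrib_left)

lemma posterior_cell: "i \<in> I \<Longrightarrow> posterior \<pi>0 (cell i) (cell i) = p i"
  using w_pos[of i] by (simp add: posterior_def pair_prob_cell joint_prob_cell vec_eq_iff)

lemma hull_posteriors:
  "convex hull (p ` I) \<subseteq> convex hull {posterior \<pi>0 s1 s2 |s1 s2.
     s1 \<in> cell ` I \<and> s2 \<in> cell ` I \<and> pair_prob \<pi>0 s1 s2 > 0}"
proof (intro hull_mono image_subsetI)
  fix i assume i: "i \<in> I"
  show "p i \<in> {posterior \<pi>0 s1 s2 |s1 s2.
     s1 \<in> cell ` I \<and> s2 \<in> cell ` I \<and> pair_prob \<pi>0 s1 s2 > 0}"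
    using i pair_prob_cell[OF i] w_pos[OF i] posterior_cell[OF i]
    by (intro CollectI exI[of _ "cell i"]) simp
qed

lemma sum_cells:
  "i \<in> I \<Longrightarrow> (\<Sum>s\<in>cell ` I. joint_prob \<pi>0 (cell i) s \<omega> * f s) = w i * p i $ \<omega> * f (cell i)"
  using finite_I
  by (simp add: sum.reindex[OF inj_cell] joint_prob_cell if_distrib if_distribR sum.delta
      cong: sum.cong if_cong)

text \<open>The message set may be infinite, but decoding leaves only finitely many values, so the
  function is bounded.\<close>

lemma integrable_decoded:
  fixes h :: "'i \<Rightarrow> real"
  assumes "\<And>m. g m \<in> I"
  shows "integrable (measure_pmf P) (\<lambda>m. h (g m))"
proof (rule measure_pmf.integrable_const_bound[where B = "\<Sum>j\<in>I. \<bar>h j\<bar>"])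
  show "AE m in measure_pmf P. norm (h (g m)) \<le> (\<Sum>j\<in>I. \<bar>h j\<bar>)"
    using assms finite_I by (simp add: member_le_sum[where f = "\<lambda>j. \<bar>h j\<bar>"])
qed simp

text \<open>Given cell \<open>i\<close>, the other expert sees the same cell and truthfully reports
  it. The deviator with belief \<open>p i\<close> therefore only chooses the first argument of
  \<open>D _ i\<close>.\<close>

lemma expected_payoff_deviation:
  assumes i: "i \<in> I" and g: "\<And>m. g m \<in> I" and g': "g' (e' (cell i)) = i"
  shows "expected_payoff W \<pi>0 {cell i} (cell ` I) (\<lambda>_. P) (\<lambda>s. return_pmf (e' s))
           (\<lambda>m m'. D (g m) (g' m'))
       = w i * measure_pmf.expectation P (\<lambda>m. payoff W (D (g m) i) (p i))"
proof -
  have "expected_payoff W \<pi>0 {cell i} (cell ` I) (\<lambda>_. P) (\<lambda>s. return_pmf (e' s))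
           (\<lambda>m m'. D (g m) (g' m'))
      = (\<Sum>\<omega>\<in>UNIV. w i * (p i $ \<omega> * measure_pmf.expectation P (\<lambda>m. payoff W (D (g m) i) (dirac \<omega>))))"
    unfolding expected_payoff_def using i by (simp add: sum_cells g' pair_return_pmf2 mult.assoc)
  also have "\<dots> = w i * (\<Sum>\<omega>\<in>UNIV. measure_pmf.expectation P (\<lambda>m. p i $ \<omega> * payoff W (D (g m) i) (dirac \<omega>)))"
    by (simp add: sum_distrib_left)
  also have "(\<Sum>\<omega>\<in>UNIV. measure_pmf.expectation P (\<lambda>m. p i $ \<omega> * payoff W (D (g m) i) (dirac \<omega>)))
      = measure_pmf.expectation P (\<lambda>m. \<Sum>\<omega>\<in>UNIV. p i $ \<omega> * payoff W (D (g m) i) (dirac \<omega>))"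
    using g by (intro Bochner_Integration.integral_sum[symmetric]
        integrable_decoded[of g _ "\<lambda>j. p i $ _ * payoff W (D j i) (dirac _)"])
  also have "\<dots> = measure_pmf.expectation P (\<lambda>m. payoff W (D (g m) i) (p i))"
    by (simp flip: payoff_eq_sum_dirac_right)
  finally show ?thesis .
qed

text \<open>A randomized report yields an average of the payoffs from pure reports, none of which
  beats the truth by \<open>le\<close>.\<close>

lemma truthful_optimal:
  assumes i: "i \<in> I" and g: "\<And>m. g m \<in> I" "g (e (cell i)) = i" and g': "g' (e' (cell i)) = i"
    and le: "\<And>j. j \<in> I \<Longrightarrow> payoff u (D j i) (p i) \<le> payoff u (D i i) (p i)"
  shows "expected_payoff u \<pi>0 {cell i} (cell ` I) (\<lambda>_. P) (\<lambda>s. return_pmf (e' s))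
           (\<lambda>m m'. D (g m) (g' m'))
       \<le> expected_payoff u \<pi>0 {cell i} (cell ` I) (\<lambda>_. return_pmf (e (cell i)))
           (\<lambda>s. return_pmf (e' s)) (\<lambda>m m'. D (g m) (g' m'))"
proof -
  have "measure_pmf.expectation P (\<lambda>m. payoff u (D (g m) i) (p i)) \<le> payoff u (D i i) (p i)"
    using integrable_decoded[of g P "\<lambda>j. payoff u (D j i) (p i)"] g(1) le
    by (intro measure_pmf.integral_le_const) auto
  then show ?thesis
    using w_pos[OF i] g(2) by 
      (simp add: expected_payoff_deviation[where g = g and g' = g' and e' = e', OF i g(1) g'])
qed

lemma expected_payoff_truthful:
  assumes g: "\<And>m. g m \<in> I" "\<And>i. i \<in> I \<Longrightarrow> g (e (cell i)) = i"
    and g': "\<And>i. i \<in> I \<Longrightarrow> g' (e' (cell i)) = i"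
  shows "expected_payoff W \<pi>0 (cell ` I) (cell ` I) (\<lambda>s. return_pmf (e s)) (\<lambda>s. return_pmf (e' s))
           (\<lambda>m m'. D (g m) (g' m'))
       = (\<Sum>i\<in>I. w i * payoff W (D i i) (p i))"
  by (subst expected_payoff_sum_signals)
    (simp add: sum.reindex[OF inj_cell] expected_payoff_deviation g g' cong: sum.cong)

end

section \<open>The cross-verification equilibrium\<close>

text \<open>Bayes plausibility in the converse direction: the likelihoods
  \<open>w i * p i $ \<omega> / \<pi>0 $ \<omega>\<close> add up to one over \<open>i\<close>
  because the posteriors average to the prior.\<close>

lemma ex_splitting_experiment:
  fixes \<pi>0 :: "real ^ 'w::finite" and I :: "'i set"
  assumes \<pi>0: "\<pi>0 \<in> prob_vecs" and I: "finite I"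
    and w: "\<And>i. i \<in> I \<Longrightarrow> 0 < w i" and p: "\<And>i. i \<in> I \<Longrightarrow> p i \<in> prob_vecs"
    and mean: "(\<Sum>i\<in>I. w i *\<^sub>R p i) = \<pi>0"
  obtains cell where "is_experiment (cell ` I)" "splitting_experiment \<pi>0 I w p cell"
proof -
  have mean_nth: "(\<Sum>i\<in>I. w i * p i $ \<omega>) = \<pi>0 $ \<omega>" for \<omega>
    by (simp flip: mean)
  have nonneg: "0 \<le> w i * p i $ \<omega>" if "i \<in> I" for i \<omega>
    using that w p by (simp add: prob_vecs_nonneg less_imp_le)
  have zero: "w i * p i $ \<omega> = 0" if "\<pi>0 $ \<omega> = 0" "i \<in> I" for i \<omega>
    using mean_nth[of \<omega>] that nonneg I by (simp add: sum_nonneg_eq_0_iff)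
  have "I \<noteq> {}"
    using mean \<pi>0 by (auto simp: prob_vecs_def)
  then obtain i0 where i0: "i0 \<in> I" by blast
  \<comment> \<open>In states of prior probability zero the quotient is meaningless; there the whole
    interval goes to the signal \<open>i0\<close>.\<close>
  define l where "l i \<omega> = (if \<pi>0 $ \<omega> = 0 then if i = i0 then 1 else 0
      else w i * p i $ \<omega> / \<pi>0 $ \<omega>)" for i \<omega>
  have l_prior: "\<pi>0 $ \<omega> * l i \<omega> = w i * p i $ \<omega>" if "i \<in> I" for i \<omega>
    using zero[of \<omega> i] that by (simp add: l_def)
  have l_nonneg: "0 \<le> l i \<omega>" if "i \<in> I" for i \<omega>
    unfolding l_def using nonneg[OF that, of \<omega>] prob_vecs_nonneg[OF \<pi>0, of \<omega>] by simp
  have l_sum: "(\<Sum>i\<in>I. l i \<omega>) = 1" for \<omega>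
  proof (cases "\<pi>0 $ \<omega> = 0")
    case True
    then show ?thesis using I i0 by (simp add: l_def)
  next
    case False
    then show ?thesis by (simp add: l_def mean_nth flip: sum_divide_distrib)
  qed
  \<comment> \<open>A state with positive weight under \<open>p i\<close> also has positive prior
    probability, so signal \<open>i\<close> occurs there.\<close>
  have l_pos: "\<exists>\<omega>. 0 < l i \<omega>" if "i \<in> I" for i
  proof -
    have "(\<Sum>\<omega>\<in>UNIV. p i $ \<omega>) \<noteq> 0"
      using p[OF that] by (simp add: prob_vecs_sum)
    then obtain \<omega> where "p i $ \<omega> \<noteq> 0"
      by (metis (lifting) sum.neutral)
    then have "\<pi>0 $ \<omega> * l i \<omega> \<noteq> 0"
      using w[OF that] by (simp add: l_prior[OF that])
    then show ?thesis
      using l_nonneg[OF that, of \<omega>] by (intro exI[of _ \<omega>]) (simp add: less_le)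
  qed
  obtain cell where cell: "inj_on cell I" "is_experiment (cell ` I)"
    "\<And>i j \<omega>. i \<in> I \<Longrightarrow> j \<in> I \<Longrightarrow> signal_prob (cell i) (cell j) \<omega> = (if i = j then l i \<omega> else 0)"
    using ex_experiment[where l = l, OF I l_nonneg l_sum l_pos] by blast
  have "splitting_experiment \<pi>0 I w p cell"
    by unfold_locales (use I w p cell in \<open>simp_all add: joint_prob_def l_prior\<close>)
  with cell(2) show thesis by (rule that)
qed

section \<open>Consistency of beliefs and the equilibrium\<close>

lemma (in splitting_experiment) message_joint_prob_truthful:
  fixes E :: "('w, 'a::finite, 'm1, 'm2) assessment"
  assumes "report1 E (cell ` I) (cell ` I) = (\<lambda>s. return_pmf (e s))"
    and "report2 E (cell ` I) (cell ` I) = (\<lambda>s. return_pmf (e' s))"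
  shows "message_joint_prob \<pi>0 E (cell ` I) (cell ` I) m1 m2 \<omega>
    = (\<Sum>i\<in>I. w i * p i $ \<omega> * (if m1 = e (cell i) \<and> m2 = e' (cell i) then 1 else 0))"
proof -
  have "message_joint_prob \<pi>0 E (cell ` I) (cell ` I) m1 m2 \<omega>
      = (\<Sum>i\<in>I. \<Sum>s2\<in>cell ` I. joint_prob \<pi>0 (cell i) s2 \<omega> *
          (pmf (return_pmf (e (cell i))) m1 * pmf (return_pmf (e' s2)) m2))"
    by (simp add: message_joint_prob_def assms sum.reindex[OF inj_cell] mult.assoc)
  also have "\<dots> = (\<Sum>i\<in>I. w i * p i $ \<omega> *
      (pmf (return_pmf (e (cell i))) m1 * pmf (return_pmf (e' (cell i))) m2))"
    by (intro sum.cong refl sum_cells)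
  also have "\<dots> = (\<Sum>i\<in>I. w i * p i $ \<omega> * (if m1 = e (cell i) \<and> m2 = e' (cell i) then 1 else 0))"
    by (intro sum.cong refl) (auto simp: indicator_def)
  finally show ?thesis .
qed

text \<open>A message pair has positive probability only if both messages encode the same cell
  \<open>i\<close>, and Bayes' rule then gives \<open>p i\<close>. After any other pair it suffices
  that the belief averages the posteriors.\<close>

lemma (in splitting_experiment) consistent_beliefs_truthful:
  fixes E :: "('w, 'a::finite, 'm1, 'm2) assessment"
  assumes reports: "report1 E (cell ` I) (cell ` I) = (\<lambda>s. return_pmf (e s))"
      "report2 E (cell ` I) (cell ` I) = (\<lambda>s. return_pmf (e' s))"
    and belief: "belief E (cell ` I) (cell ` I) = (\<lambda>m1 m2. B (g m1) (g' m2))"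
    and g: "\<And>m. g m \<in> I" "\<And>i. i \<in> I \<Longrightarrow> g (e (cell i)) = i"
    and g': "\<And>m. g' m \<in> I" "\<And>i. i \<in> I \<Longrightarrow> g' (e' (cell i)) = i"
    and B_diag: "\<And>i. i \<in> I \<Longrightarrow> B i i = p i"
    and B_hull: "\<And>i j. i \<in> I \<Longrightarrow> j \<in> I \<Longrightarrow> B i j \<in> convex hull (p ` I)"
  shows "consistent_beliefs \<pi>0 E (cell ` I) (cell ` I)"
  unfolding consistent_beliefs_def
proof (intro allI)
  fix m1 m2
  let ?S = "cell ` I"
  note joint = message_joint_prob_truthful[OF reports]
  show "if message_prob \<pi>0 E ?S ?S m1 m2 > 0
    then belief E ?S ?S m1 m2 =
      (\<chi> \<omega>. message_joint_prob \<pi>0 E ?S ?S m1 m2 \<omega> / message_prob \<pi>0 E ?S ?S m1 m2)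
    else belief E ?S ?S m1 m2 \<in> convex hull
      {posterior \<pi>0 s1 s2 |s1 s2. s1 \<in> ?S \<and> s2 \<in> ?S \<and> pair_prob \<pi>0 s1 s2 > 0}"
  proof (cases "\<exists>i\<in>I. m1 = e (cell i) \<and> m2 = e' (cell i)")
    case True
    then obtain i where i: "i \<in> I" "m1 = e (cell i)" "m2 = e' (cell i)" by blast
    \<comment> \<open>Decoding \<open>m1\<close> recovers the index, so a single term survives in
      the sum for the joint probability.\<close>
    have "m1 = e (cell j) \<and> m2 = e' (cell j) \<longleftrightarrow> j = i" if "j \<in> I" for j
      using g(2)[OF i(1)] g(2)[OF that] unfolding i(2,3) by metis
    then have mjp: "message_joint_prob \<pi>0 E ?S ?S m1 m2 \<omega> = w i * p i $ \<omega>" for \<omega>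
      unfolding joint using finite_I i(1)
      by (simp add: if_distrib sum.delta cong: sum.cong if_cong)
    then have mp: "message_prob \<pi>0 E ?S ?S m1 m2 = w i"
      using i(1) by (simp add: message_prob_def prob_vecs_sum p_prob flip: sum_distrib_left)
    have "belief E ?S ?S m1 m2 = p i"
      using i by (simp add: belief g g' B_diag)
    with w_pos[OF i(1)] show ?thesis
      by (simp add: mjp mp vec_eq_iff)
  next
    case False
    then have "message_joint_prob \<pi>0 E ?S ?S m1 m2 \<omega> = 0" for \<omega>
      unfolding joint by (intro sum.neutral) auto
    then have "message_prob \<pi>0 E ?S ?S m1 m2 = 0"
      by (simp add: message_prob_def)
    moreover have "belief E ?S ?S m1 m2 \<in> convex hull
      {posterior \<pi>0 s1 s2 |s1 s2. s1 \<in> ?S \<and> s2 \<in> ?S \<and> pair_prob \<pi>0 s1 s2 > 0}"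
      unfolding belief using B_hull[OF g(1) g'(1)] hull_posteriors by blast
    ultimately show ?thesis by simp
  qed
qed

text \<open>Reports do not depend on signals, so the message probability factors out of Bayes' rule
  and the prior remains.\<close>

lemma consistent_beliefs_babbling:
  fixes E :: "('w::finite, 'a::finite, 'm1, 'm2) assessment"
  assumes \<pi>0: "\<pi>0 \<in> prob_vecs" and \<sigma>: "is_experiment \<sigma>1" "is_experiment \<sigma>2"
    and reports: "report1 E \<sigma>1 \<sigma>2 = (\<lambda>_. t1)" "report2 E \<sigma>2 \<sigma>1 = (\<lambda>_. t2)"
    and belief: "belief E \<sigma>1 \<sigma>2 = (\<lambda>_ _. \<pi>0)"
  shows "consistent_beliefs \<pi>0 E \<sigma>1 \<sigma>2"
  unfolding consistent_beliefs_def
proof (intro allI)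
  fix m1 m2
  have mjp: "message_joint_prob \<pi>0 E \<sigma>1 \<sigma>2 m1 m2 \<omega> = \<pi>0 $ \<omega> * (pmf t1 m1 * pmf t2 m2)" for \<omega>
    by (simp add: message_joint_prob_def reports mult.assoc sum_joint_prob[OF \<sigma>]
        flip: sum_distrib_right)
  then have mp: "message_prob \<pi>0 E \<sigma>1 \<sigma>2 m1 m2 = pmf t1 m1 * pmf t2 m2"
    by (simp add: message_prob_def prob_vecs_sum[OF \<pi>0] flip: sum_distrib_right)
  show "if message_prob \<pi>0 E \<sigma>1 \<sigma>2 m1 m2 > 0
    then belief E \<sigma>1 \<sigma>2 m1 m2 =
      (\<chi> \<omega>. message_joint_prob \<pi>0 E \<sigma>1 \<sigma>2 m1 m2 \<omega> / message_prob \<pi>0 E \<sigma>1 \<sigma>2 m1 m2)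
    else belief E \<sigma>1 \<sigma>2 m1 m2 \<in> convex hull
      {posterior \<pi>0 s1 s2 |s1 s2. s1 \<in> \<sigma>1 \<and> s2 \<in> \<sigma>2 \<and> pair_prob \<pi>0 s1 s2 > 0}"
  proof (cases "pmf t1 m1 * pmf t2 m2 > 0")
    case True
    then have "pmf t1 m1 * pmf t2 m2 \<noteq> 0"
      by linarith
    then have "(\<chi> \<omega>. \<pi>0 $ \<omega> * (pmf t1 m1 * pmf t2 m2) / (pmf t1 m1 * pmf t2 m2)) = \<pi>0"
      by (simp only: nonzero_mult_div_cancel_right vec_lambda_eta not_False_eq_True)
    with True show ?thesis
      unfolding mjp mp belief by simp
  next
    case False
    with prior_in_hull_posteriors[OF \<sigma> \<pi>0] show ?thesis
      unfolding mp belief by simp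
  qed
qed

text \<open>Since the signals coincide, a truthful opponent reveals the true index \<open>i\<close>
  and a lie produces \<open>D j i\<close> or \<open>D i j\<close>; \<open>IC1\<close> and
  \<open>IC2\<close> deter the two experts from it. Choosing another experiment leads to babbling
  with \<alpha>0, which \<open>benefit\<close> makes unattractive. The reports, beliefs and
  decisions so described form the equilibrium.\<close>

lemma cross_verification_equilibrium:
  fixes u v :: "('a::finite, 'w::finite) payoff_fun" and I :: "'i set"
    and D :: "'i \<Rightarrow> 'i \<Rightarrow> real ^ 'a" and B :: "'i \<Rightarrow> 'i \<Rightarrow> real ^ 'w"
  assumes rich1: "\<And>\<sigma> :: 'w stat_experiment. is_experiment \<sigma> \<Longrightarrow> \<exists>e :: 'w signal \<Rightarrow> 'm1. inj_on e \<sigma>"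
    and rich2: "\<And>\<sigma> :: 'w stat_experiment. is_experiment \<sigma> \<Longrightarrow> \<exists>e :: 'w signal \<Rightarrow> 'm2. inj_on e \<sigma>"
    and \<pi>0: "\<pi>0 \<in> prob_vecs" and I: "finite I"
    and w: "\<And>i. i \<in> I \<Longrightarrow> 0 < w i" and p: "\<And>i. i \<in> I \<Longrightarrow> p i \<in> prob_vecs"
    and mean: "(\<Sum>i\<in>I. w i *\<^sub>R p i) = \<pi>0"
    and B_diag: "\<And>i. i \<in> I \<Longrightarrow> B i i = p i"
    and B_hull: "\<And>i j. i \<in> I \<Longrightarrow> j \<in> I \<Longrightarrow> B i j \<in> convex hull (p ` I)"
    and D: "\<And>i j. i \<in> I \<Longrightarrow> j \<in> I \<Longrightarrow> D i j \<in> BR v (B i j)"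
    and IC1: "\<And>i j. i \<in> I \<Longrightarrow> j \<in> I \<Longrightarrow> payoff u (D j i) (p i) \<le> payoff u (D i i) (p i)"
    and IC2: "\<And>i j. i \<in> I \<Longrightarrow> j \<in> I \<Longrightarrow> payoff u (D i j) (p i) \<le> payoff u (D i i) (p i)"
    and \<alpha>0: "\<alpha>0 \<in> BR v \<pi>0"
    and benefit: "payoff u \<alpha>0 \<pi>0 \<le> (\<Sum>i\<in>I. w i * payoff u (D i i) (p i))"
  shows "\<exists>E :: ('w, 'a, 'm1, 'm2) assessment.
    equilibrium u v \<pi>0 E \<and> eq_payoff v \<pi>0 E = (\<Sum>i\<in>I. w i * payoff v (D i i) (p i))"
proof -
  obtain cell where exp: "is_experiment (cell ` I)" and "splitting_experiment \<pi>0 I w p cell"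
    using ex_splitting_experiment[OF \<pi>0 I w p mean] by blast
  then interpret splitting_experiment \<pi>0 I w p cell by simp
  let ?S = "cell ` I"
  have "I \<noteq> {}"
    using mean \<pi>0 by (auto simp: prob_vecs_def)
  then obtain i0 where i0: "i0 \<in> I" by blast
  obtain e1 :: "'w signal \<Rightarrow> 'm1" where "inj_on e1 ?S" using rich1[OF exp] by blast
  then have "inj_on (\<lambda>i. e1 (cell i)) I"
    using comp_inj_on[OF inj_cell] by (simp add: o_def)
  then obtain g1 where g1: "\<And>i. i \<in> I \<Longrightarrow> g1 (e1 (cell i)) = i" "\<And>m. g1 m \<in> I"
    using ex_decoder[OF _ i0] by blast
  obtain e2 :: "'w signal \<Rightarrow> 'm2" where "inj_on e2 ?S" using rich2[OF exp] by blast
  then have "inj_on (\<lambda>i. e2 (cell i)) I"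
    using comp_inj_on[OF inj_cell] by (simp add: o_def)
  then obtain g2 where g2: "\<And>i. i \<in> I \<Longrightarrow> g2 (e2 (cell i)) = i" "\<And>m. g2 m \<in> I"
    using ex_decoder[OF _ i0] by blast
  \<comment> \<open>Unless both experiments equal \<open>?S\<close>, both experts send one fixed
    message, for which \<open>undefined\<close> serves, and the decision-maker ignores all
    messages.\<close>
  define E :: "('w, 'a, 'm1, 'm2) assessment" where
    "E = \<lparr>exper1 = ?S, exper2 = ?S,
      report1 = \<lambda>\<sigma>1 \<sigma>2 s. return_pmf (if \<sigma>1 = ?S \<and> \<sigma>2 = ?S then e1 s else undefined),
      report2 = \<lambda>\<sigma>2 \<sigma>1 s. return_pmf (if \<sigma>1 = ?S \<and> \<sigma>2 = ?S then e2 s else undefined),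
      decision = \<lambda>\<sigma>1 \<sigma>2 m1 m2. if \<sigma>1 = ?S \<and> \<sigma>2 = ?S then D (g1 m1) (g2 m2) else \<alpha>0,
      belief = \<lambda>\<sigma>1 \<sigma>2 m1 m2. if \<sigma>1 = ?S \<and> \<sigma>2 = ?S then B (g1 m1) (g2 m2) else \<pi>0\<rparr>"
  have on_path: "report1 E ?S ?S = (\<lambda>s. return_pmf (e1 s))"
    "report2 E ?S ?S = (\<lambda>s. return_pmf (e2 s))"
    "decision E ?S ?S = (\<lambda>m1 m2. D (g1 m1) (g2 m2))"
    "belief E ?S ?S = (\<lambda>m1 m2. B (g1 m1) (g2 m2))"
    by (simp_all add: E_def)
  have off_path: "report1 E \<sigma>1 \<sigma>2 = (\<lambda>_. return_pmf undefined)"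
    "report2 E \<sigma>2 \<sigma>1 = (\<lambda>_. return_pmf undefined)"
    "decision E \<sigma>1 \<sigma>2 = (\<lambda>_ _. \<alpha>0)" "belief E \<sigma>1 \<sigma>2 = (\<lambda>_ _. \<pi>0)"
    if "\<not> (\<sigma>1 = ?S \<and> \<sigma>2 = ?S)" for \<sigma>1 \<sigma>2
    by (simp_all add: E_def if_not_P[OF that])
  have payoff_on_path: "subgame_payoff W \<pi>0 E ?S ?S = (\<Sum>i\<in>I. w i * payoff W (D i i) (p i))"
    for W :: "('a, 'w) payoff_fun"
    unfolding subgame_payoff_def on_path
    by (rule expected_payoff_truthful[where g = g1 and g' = g2]) (simp_all add: g1 g2)
  have payoff_off_path: "subgame_payoff W \<pi>0 E \<sigma>1 \<sigma>2 = payoff W \<alpha>0 \<pi>0"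
    if "is_experiment \<sigma>1" "is_experiment \<sigma>2" "\<not> (\<sigma>1 = ?S \<and> \<sigma>2 = ?S)"
    for \<sigma>1 \<sigma>2 and W :: "('a, 'w) payoff_fun"
    unfolding subgame_payoff_def off_path(3)[OF that(3)]
    using that by (intro expected_payoff_babbling)
  have exper: "exper1 E = ?S" "exper2 E = ?S"
    by (simp_all add: E_def)
  have subgame: "consistent_beliefs \<pi>0 E \<sigma>1 \<sigma>2 \<and> sequentially_rational_decision v E \<sigma>1 \<sigma>2 \<and>
      optimal_report1 u \<pi>0 E \<sigma>1 \<sigma>2 \<and> optimal_report2 u \<pi>0 E \<sigma>1 \<sigma>2"
    if \<sigma>: "is_experiment \<sigma>1" "is_experiment \<sigma>2" for \<sigma>1 \<sigma>2
  proof (cases "\<sigma>1 = ?S \<and> \<sigma>2 = ?S")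
    case True
    have "consistent_beliefs \<pi>0 E ?S ?S"
      by (rule consistent_beliefs_truthful[OF on_path(1,2,4)]) (simp_all add: g1 g2 B_diag B_hull)
    moreover have "sequentially_rational_decision v E ?S ?S"
      unfolding sequentially_rational_decision_def on_path by (simp add: D g1 g2)
    moreover have "optimal_report1 u \<pi>0 E ?S ?S"
      unfolding optimal_report1_def on_path Let_def
    proof safe
      fix i P assume i: "i \<in> I" and "own_signal_prob \<pi>0 (cell i) > 0"
      then show "expected_payoff u \<pi>0 {cell i} ?S (\<lambda>_. P) (\<lambda>s. return_pmf (e2 s))
            (\<lambda>m1 m2. D (g1 m1) (g2 m2)) / own_signal_prob \<pi>0 (cell i)
          \<le> expected_payoff u \<pi>0 {cell i} ?S (\<lambda>_. return_pmf (e1 (cell i)))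
            (\<lambda>s. return_pmf (e2 s)) (\<lambda>m1 m2. D (g1 m1) (g2 m2)) / own_signal_prob \<pi>0 (cell i)"
        by (intro divide_right_mono truthful_optimal[where g = g1 and g' = g2])
          (simp_all add: g1 g2 IC1)
    qed
    \<comment> \<open>Exchanging the experts' roles turns this into the previous argument, with the
      arguments of \<open>D\<close> transposed.\<close>
    moreover have "optimal_report2 u \<pi>0 E ?S ?S"
      unfolding optimal_report2_def on_path Let_def expected_payoff_swap[of u \<pi>0 ?S]
    proof safe
      fix i P assume i: "i \<in> I" and "own_signal_prob \<pi>0 (cell i) > 0"
      then show "expected_payoff u \<pi>0 {cell i} ?S (\<lambda>_. P) (\<lambda>s. return_pmf (e1 s))
            (\<lambda>m2 m1. D (g1 m1) (g2 m2)) / own_signal_prob \<pi>0 (cell i)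
          \<le> expected_payoff u \<pi>0 {cell i} ?S (\<lambda>_. return_pmf (e2 (cell i)))
            (\<lambda>s. return_pmf (e1 s)) (\<lambda>m2 m1. D (g1 m1) (g2 m2)) / own_signal_prob \<pi>0 (cell i)"
        by (intro divide_right_mono truthful_optimal[where g = g2 and g' = g1 and D = "\<lambda>j i. D i j"])
          (simp_all add: g1 g2 IC2)
    qed
    ultimately show ?thesis using True by simp
  next
    case False
    note off = off_path[OF False]
    have "consistent_beliefs \<pi>0 E \<sigma>1 \<sigma>2"
      by (rule consistent_beliefs_babbling[OF \<pi>0 \<sigma> off(1,2,4)])
    moreover have "sequentially_rational_decision v E \<sigma>1 \<sigma>2"
      unfolding sequentially_rational_decision_def off by (simp add: \<alpha>0)
    \<comment> \<open>Under a constant decision the payoff does not depend on the report, so all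
      reports are equally good.\<close>
    moreover have "optimal_report1 u \<pi>0 E \<sigma>1 \<sigma>2" "optimal_report2 u \<pi>0 E \<sigma>1 \<sigma>2"
      unfolding optimal_report1_def optimal_report2_def off expected_payoff_const_decision
      by simp_all
    ultimately show ?thesis by simp
  qed
  have "equilibrium u v \<pi>0 E"
    unfolding equilibrium_def eq_payoff_def exper
  proof (intro conjI allI impI)
    show "subgame_payoff u \<pi>0 E \<sigma> ?S \<le> subgame_payoff u \<pi>0 E ?S ?S" if "is_experiment \<sigma>" for \<sigma>
      using payoff_off_path[OF that exp, of u] benefit
      by (cases "\<sigma> = ?S") (simp_all add: payoff_on_path)
    show "subgame_payoff u \<pi>0 E ?S \<sigma> \<le> subgame_payoff u \<pi>0 E ?S ?S" if "is_experiment \<sigma>" for \<sigma>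
      using payoff_off_path[OF exp that, of u] benefit
      by (cases "\<sigma> = ?S") (simp_all add: payoff_on_path)
  qed (use exp subgame in auto)
  then show ?thesis
    using payoff_on_path[of v] by (auto simp: eq_payoff_def exper)
qed

section \<open>Optimal splittings and punishments\<close>

text \<open>
  No best reply along the segment benefits both types at once, so, by upper hemicontinuity
  and convexity of best replies, at some belief there is one that benefits neither.
\<close>

lemma ex_punishment:
  fixes v :: "('a::finite, 'w::finite) payoff_fun"
  assumes no_gain: "\<And>t \<alpha>. t \<in> {0..1} \<Longrightarrow> \<alpha> \<in> BR v ((1 - t) *\<^sub>R p + t *\<^sub>R q) \<Longrightarrow>
      (1 - t) * payoff u \<alpha> p + t * payoff u \<alpha> q \<le> (1 - t) * c + t * d"
  shows "\<exists>t\<in>{0..1}. \<exists>\<alpha>\<in>BR v ((1 - t) *\<^sub>R p + t *\<^sub>R q). payoff u \<alpha> p \<le> c \<and> payoff u \<alpha> q \<le> d"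
proof -
  define b where "b t = (1 - t) *\<^sub>R p + t *\<^sub>R q" for t
  have cont_b [continuous_intros]: "continuous_on S (\<lambda>x. b (f x))" if "continuous_on S f"
    for f :: "real \<times> (real ^ 'a) \<Rightarrow> real" and S
    unfolding b_def by (intro continuous_intros that)
  \<comment> \<open>If \<alpha> exceeded both bounds, the weighted average would exceed its bound.
    At \<open>t = 1\<close> strictness has to come from \<open>q\<close> alone.\<close>
  have either: "payoff u \<alpha> p \<le> c \<or> payoff u \<alpha> q \<le> d" if "t \<in> {0..1}" "\<alpha> \<in> BR v (b t)" for t \<alpha>
  proof (rule ccontr)
    assume "\<not> (payoff u \<alpha> p \<le> c \<or> payoff u \<alpha> q \<le> d)"
    then have gt: "c < payoff u \<alpha> p" "d < payoff u \<alpha> q" by auto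
    have "(1 - t) * c + t * d < (1 - t) * payoff u \<alpha> p + t * payoff u \<alpha> q"
    proof (cases "t = 1")
      case True
      then show ?thesis using gt by simp
    next
      case False
      then show ?thesis
        using that(1) gt by (intro add_less_le_mono mult_strict_left_mono mult_left_mono) auto
    qed
    with no_gain[OF that[unfolded b_def]] show False by simp
  qed
  let ?G = "{x \<in> {0..1} \<times> prob_vecs. snd x \<in> BR v (b (fst x))}"
  have "?G = ({0..1} \<times> prob_vecs) \<inter> (\<lambda>x. (b (fst x), snd x)) -` {(\<pi>, \<alpha>). \<alpha> \<in> BR v \<pi>}"
    by auto
  also have "compact \<dots>"
    by (intro compact_Int_closed compact_Times compact_Icc compact_prob_vecs closed_vimage
        closed_BR_graph continuous_intros)
  finally have G: "compact ?G" .
  \<comment> \<open>The mixing weights at which some best reply holds the type with belief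
    \<open>r\<close> down to \<open>z\<close>. As the projection of a compact set,
    \<open>T r z\<close> is closed.\<close>
  define T where "T r z = fst ` (?G \<inter> {x. payoff u (snd x) r \<le> z})" for r z
  have T_iff: "t \<in> T r z \<longleftrightarrow> t \<in> {0..1} \<and> (\<exists>\<alpha>\<in>BR v (b t). payoff u \<alpha> r \<le> z)" for t r z
    unfolding T_def using BR_subset[of v "b t"] by (force simp: image_iff)
  have closed_T: "closed (T r z)" for r z
    unfolding T_def
    by (intro compact_imp_closed compact_continuous_image compact_Int_closed G closed_Collect_le
        continuous_intros)
  have BR_ne: "\<exists>\<alpha>. \<alpha> \<in> BR v (b t)" for t
    using ex_dirac_BR by blast
  \<comment> \<open>At the two ends the pooled belief is one of the posteriors, and
    \<open>no_gain\<close> bounds the payoff of that type. The interval is thus covered by two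
    closed sets that both meet it, and connectedness yields a common \<open>t\<close>.\<close>
  have "1 \<in> T q d \<inter> {0..1}"
  proof -
    obtain \<alpha> where "\<alpha> \<in> BR v (b 1)" using BR_ne by blast
    then show ?thesis
      using no_gain[of 1 \<alpha>] by (auto simp: T_iff b_def)
  qed
  moreover have "0 \<in> T p c \<inter> {0..1}"
  proof -
    obtain \<alpha> where "\<alpha> \<in> BR v (b 0)" using BR_ne by blast
    then show ?thesis
      using no_gain[of 0 \<alpha>] by (auto simp: T_iff b_def)
  qed
  moreover have "{0..1} \<subseteq> T p c \<union> T q d"
  proof
    fix t :: real assume t: "t \<in> {0..1}"
    obtain \<alpha> where "\<alpha> \<in> BR v (b t)" using BR_ne by blast
    with either[OF t this] t show "t \<in> T p c \<union> T q d"
      unfolding Un_iff T_iff by blast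
  qed
  ultimately have "T p c \<inter> T q d \<inter> {0..1} \<noteq> {}"
    using connected_closedD[OF connected_Icc _ _ closed_T closed_T, of p c q d 0 1] by blast
  then obtain t where t: "t \<in> {0..1}" "t \<in> T p c" "t \<in> T q d" by blast
  \<comment> \<open>At this \<open>t\<close> each bound is met by some best reply, possibly by
    different ones. The convex set of best replies is covered by the two closed half-spaces, so one
    best reply meets both bounds.\<close>
  have "connected (BR v (b t))"
    by (intro convex_connected convex_BR)
  moreover have "closed {\<alpha>. payoff u \<alpha> r \<le> z}" for r z
    by (intro closed_Collect_le continuous_intros)
  moreover have "BR v (b t) \<subseteq> {\<alpha>. payoff u \<alpha> p \<le> c} \<union> {\<alpha>. payoff u \<alpha> q \<le> d}"
    using either[OF t(1)] by blast
  moreover have "{\<alpha>. payoff u \<alpha> p \<le> c} \<inter> BR v (b t) \<noteq> {}" "{\<alpha>. payoff u \<alpha> q \<le> d} \<inter> BR v (b t) \<noteq> {}"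
    using t(2,3) unfolding T_iff by blast+
  ultimately have "{\<alpha>. payoff u \<alpha> p \<le> c} \<inter> {\<alpha>. payoff u \<alpha> q \<le> d} \<inter> BR v (b t) \<noteq> {}"
    using connected_closedD[of "BR v (b t)"] by meson
  with t(1) show ?thesis
    unfolding b_def by blast
qed

text \<open>
  The convex hull of the graph of the experts' attainable payoffs is compact; an optimal
  splitting is read off a highest point of this hull above the prior, and it cannot be
  improved by pooling mass from two of its posteriors.
\<close>

lemma ex_optimal_splitting:
  fixes u v :: "('a::finite, 'w::finite) payoff_fun"
  assumes \<pi>0: "\<pi>0 \<in> prob_vecs"
  obtains I :: "((real ^ 'w) \<times> real) set" and w \<alpha> where
    "finite I" "\<And>i. i \<in> I \<Longrightarrow> 0 < w i" "\<And>i. i \<in> I \<Longrightarrow> fst i \<in> prob_vecs"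
    "\<And>i. i \<in> I \<Longrightarrow> \<alpha> i \<in> BR v (fst i)" "(\<Sum>i\<in>I. w i *\<^sub>R fst i) = \<pi>0"
    "cav (u_bar u v) \<pi>0 \<le> (\<Sum>i\<in>I. w i * payoff u (\<alpha> i) (fst i))"
    "\<And>i j t \<beta>. i \<in> I \<Longrightarrow> j \<in> I \<Longrightarrow> t \<in> {0..1} \<Longrightarrow> \<beta> \<in> BR v ((1 - t) *\<^sub>R fst i + t *\<^sub>R fst j) \<Longrightarrow>
      (1 - t) * payoff u \<beta> (fst i) + t * payoff u \<beta> (fst j)
        \<le> (1 - t) * payoff u (\<alpha> i) (fst i) + t * payoff u (\<alpha> j) (fst j)"
proof -
  let ?G = "{(\<pi>, \<alpha>). \<pi> \<in> prob_vecs \<and> \<alpha> \<in> BR v \<pi>}"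
  \<comment> \<open>Pairs of a belief and a payoff that the experts can get from a best reply at
    that belief.\<close>
  define K where "K = (\<lambda>x. (fst x, payoff u (snd x) (fst x))) ` ?G"
  define H where "H = convex hull K"
  have "compact K"
    unfolding K_def by (intro compact_continuous_image compact_BR_graph continuous_intros)
  then have H: "compact H" "convex H"
    by (simp_all add: H_def compact_convex_hull convex_convex_hull)
  have K_I: "(\<pi>, payoff u \<beta> \<pi>) \<in> K" if "\<pi> \<in> prob_vecs" "\<beta> \<in> BR v \<pi>" for \<pi> \<beta>
    unfolding K_def using that by (intro image_eqI[of _ _ "(\<pi>, \<beta>)"]) auto
  have KH: "K \<subseteq> H"
    by (simp add: H_def hull_subset)
  \<comment> \<open>Compactness gives the fibre of \<open>H\<close> above each belief a highest
    point; \<open>f\<close> is the resulting upper boundary.\<close>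
  have "\<exists>t. (\<pi>, t) \<in> H \<and> (\<forall>s. (\<pi>, s) \<in> H \<longrightarrow> s \<le> t)" if \<pi>: "\<pi> \<in> prob_vecs" for \<pi>
  proof -
    have cpt: "compact (H \<inter> {x. fst x = \<pi>})"
      using H(1) by (intro compact_Int_closed closed_Collect_eq continuous_intros)
    obtain a where "dirac a \<in> BR v \<pi>" using ex_dirac_BR by blast
    with K_I[OF \<pi>] KH have "H \<inter> {x. fst x = \<pi>} \<noteq> {}" by fastforce
    with cpt have "\<exists>x\<in>H \<inter> {x. fst x = \<pi>}. \<forall>y\<in>H \<inter> {x. fst x = \<pi>}. snd y \<le> snd x"
      by (intro continuous_attains_sup continuous_intros)
    then obtain x where x: "x \<in> H" "fst x = \<pi>" "\<forall>y\<in>H \<inter> {x. fst x = \<pi>}. snd y \<le> snd x"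
      by blast
    have "s \<le> snd x" if "(\<pi>, s) \<in> H" for s
      using x(3) that by force
    moreover have "(\<pi>, snd x) \<in> H"
      using x(1,2) by (metis prod.collapse)
    ultimately show ?thesis
      by blast
  qed
  then obtain f where f: "\<And>\<pi>. \<pi> \<in> prob_vecs \<Longrightarrow> (\<pi>, f \<pi>) \<in> H"
    "\<And>\<pi> s. \<pi> \<in> prob_vecs \<Longrightarrow> (\<pi>, s) \<in> H \<Longrightarrow> s \<le> f \<pi>"
    by metis
  \<comment> \<open>The upper boundary of a convex set is concave, and it lies above
    \<open>u_bar\<close> because \<open>H\<close> contains \<open>K\<close>. It therefore bounds the
    concavification.\<close>
  have "concave_on prob_vecs f"
    unfolding concave_on_iff
  proof (intro conjI convex_prob_vecs ballI allI impI)
    fix x y :: "real ^ 'w" and s t :: real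
    assume xy: "x \<in> prob_vecs" "y \<in> prob_vecs" and st: "0 \<le> s" "0 \<le> t" "s + t = 1"
    have "s *\<^sub>R (x, f x) + t *\<^sub>R (y, f y) \<in> H"
      using convexD[OF H(2) f(1)[OF xy(1)] f(1)[OF xy(2)] st] .
    moreover have "s *\<^sub>R x + t *\<^sub>R y \<in> prob_vecs"
      using convexD[OF convex_prob_vecs xy st] .
    ultimately show "s * f x + t * f y \<le> f (s *\<^sub>R x + t *\<^sub>R y)"
      by (intro f(2)) simp_all
  qed
  moreover have "u_bar u v \<pi> \<le> f \<pi>" if \<pi>: "\<pi> \<in> prob_vecs" for \<pi>
  proof -
    obtain \<beta> where "\<beta> \<in> BR v \<pi>" "u_bar u v \<pi> = payoff u \<beta> \<pi>"
      using u_bar_attained by blast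
    with K_I[OF \<pi>] KH show ?thesis
      by (metis f(2)[OF \<pi>] subsetD)
  qed
  ultimately have cav_le: "cav (u_bar u v) \<pi>0 \<le> f \<pi>0"
    using \<pi>0 by (rule cav_least)
  obtain J c where J: "finite J" "J \<subseteq> K" "\<forall>x\<in>J. 0 \<le> c x" "sum c J = 1"
    "(\<Sum>x\<in>J. c x *\<^sub>R x) = (\<pi>0, f \<pi>0)"
    using f(1)[OF \<pi>0] unfolding H_def convex_hull_explicit by blast
  \<comment> \<open>Points of zero weight are dropped, because signals need positive probability.
    The indices are pairs, so the same posterior may occur with different payoffs.\<close>
  define I where "I = {x \<in> J. 0 < c x}"
  have I: "finite I" "I \<subseteq> K" "\<And>i. i \<in> I \<Longrightarrow> 0 < c i"
    using J by (auto simp: I_def)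
  have c_0: "\<forall>x\<in>J - I. c x = 0"
    using J(3) by (auto simp: I_def not_less intro: antisym)
  have I_sub: "I \<subseteq> J"
    by (auto simp: I_def)
  have sum_I: "sum c I = 1"
    using J(4) sum.mono_neutral_left[OF J(1) I_sub c_0] by simp
  have "(\<Sum>x\<in>I. c x *\<^sub>R x) = (\<Sum>x\<in>J. c x *\<^sub>R x)"
    using c_0 by (intro sum.mono_neutral_left J(1) I_sub) simp
  then have mean: "(\<Sum>x\<in>I. c x *\<^sub>R x) = (\<pi>0, f \<pi>0)"
    using J(5) by simp
  have "\<forall>i\<in>I. \<exists>\<beta>. fst i \<in> prob_vecs \<and> \<beta> \<in> BR v (fst i) \<and> snd i = payoff u \<beta> (fst i)"
    using I(2) by (force simp: K_def)
  then obtain \<alpha> where \<alpha>: "\<And>i. i \<in> I \<Longrightarrow> fst i \<in> prob_vecs" "\<And>i. i \<in> I \<Longrightarrow> \<alpha> i \<in> BR v (fst i)"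
    "\<And>i. i \<in> I \<Longrightarrow> snd i = payoff u (\<alpha> i) (fst i)"
    by metis
  have mean_fst: "(\<Sum>i\<in>I. c i *\<^sub>R fst i) = \<pi>0"
    using arg_cong[OF mean, of fst] by (simp add: fst_sum)
  have mean_snd: "(\<Sum>i\<in>I. c i * snd i) = f \<pi>0"
    using arg_cong[OF mean, of snd] by (simp add: snd_sum)
  \<comment> \<open>A small mass \<open>e\<close> is taken from \<open>i\<close> and
    \<open>j\<close> in proportions \<open>1 - t\<close> and \<open>t\<close> and moved to
    \<open>z\<close>. The new point of \<open>H\<close> still lies above \<pi>0, so its height
    cannot exceed \<open>f \<pi>0\<close>.\<close>
  have no_gain: "payoff u \<beta> z \<le> (1 - t) * snd i + t * snd j"
    if ij: "i \<in> I" "j \<in> I" and t: "t \<in> {0..1}" and z: "z = (1 - t) *\<^sub>R fst i + t *\<^sub>R fst j"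
      and \<beta>: "\<beta> \<in> BR v z" for i j t \<beta> z
  proof -
    \<comment> \<open>Half the smaller weight keeps the modified weights \<open>c'\<close>
      nonnegative, also when \<open>i = j\<close>, and leaves \<open>1 - e\<close> positive for the
      renormalization.\<close>
    define e where "e = min (c i) (c j) / 2"
    define y where "y = (1 - t) *\<^sub>R i + t *\<^sub>R j"
    define c' where "c' k = c k - e * ((if k = i then 1 - t else 0) + (if k = j then t else 0))" for k
    have c_le: "c k \<le> 1" if "k \<in> I" for k
      using member_le_sum[of k I c] that I sum_I by (simp add: less_imp_le)
    have e: "0 < e" "e < 1" "e \<le> c i" "e \<le> c j"
      using I(3)[OF ij(1)] I(3)[OF ij(2)] c_le[OF ij(1)] by (auto simp: e_def)
    have c'_nonneg: "0 \<le> c' k" if "k \<in> I" for k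
    proof -
      have "e * ((if k = i then 1 - t else 0) + (if k = j then t else 0))
          \<le> e * (if k = i \<or> k = j then 1 else 0)"
        using t e(1) by (intro mult_left_mono) auto
      also have "\<dots> \<le> c k"
        using e(3,4) I(3)[OF that] by auto
      finally show ?thesis by (simp add: c'_def)
    qed
    have sum_c': "(\<Sum>k\<in>I. c' k *\<^sub>R h k) = (\<Sum>k\<in>I. c k *\<^sub>R h k) - e *\<^sub>R ((1 - t) *\<^sub>R h i + t *\<^sub>R h j)"
      for h :: "(real ^ 'w) \<times> real \<Rightarrow> 'z::real_vector"
    proof -
      have "(\<Sum>k\<in>I. c' k *\<^sub>R h k) = (\<Sum>k\<in>I. c k *\<^sub>R h k)
          - e *\<^sub>R ((\<Sum>k\<in>I. (if k = i then (1 - t) *\<^sub>R h k else 0)) + (\<Sum>k\<in>I. (if k = j then t *\<^sub>R h k else 0)))"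
        unfolding sum.distrib[symmetric] scaleR_sum_right sum_subtractf[symmetric] c'_def
        by (intro sum.cong refl) (auto simp: algebra_simps)
      then show ?thesis using ij I(1) by simp
    qed
    have sum_c'_1: "sum c' I = 1 - e"
      using sum_c'[of "\<lambda>_. 1::real"] sum_I by (simp flip: distrib_right)
    have "(\<Sum>k\<in>I. (c' k / (1 - e)) *\<^sub>R k) \<in> H"
      using I(2) KH e(2) c'_nonneg
      by (intro convex_sum I(1) H(2)) (auto simp: sum_c'_1 simp flip: sum_divide_distrib)
    moreover have z_prob: "z \<in> prob_vecs"
      unfolding z using t \<alpha>(1) ij by (intro convexD[OF convex_prob_vecs]) auto
    then have "(z, payoff u \<beta> z) \<in> H"
      using K_I \<beta> KH by blast
    ultimately have "(1 - e) *\<^sub>R (\<Sum>k\<in>I. (c' k / (1 - e)) *\<^sub>R k) + e *\<^sub>R (z, payoff u \<beta> z) \<in> H"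
      using e by (intro convexD[OF H(2)]) auto
    also have "(1 - e) *\<^sub>R (\<Sum>k\<in>I. (c' k / (1 - e)) *\<^sub>R k) = (\<Sum>k\<in>I. c' k *\<^sub>R k)"
      using e(2) by (simp add: scaleR_sum_right)
    also have "\<dots> = (\<pi>0, f \<pi>0) - e *\<^sub>R y"
      using sum_c'[of "\<lambda>k. k"] by (simp add: mean y_def)
    also have "(\<pi>0, f \<pi>0) - e *\<^sub>R y + e *\<^sub>R (z, payoff u \<beta> z)
        = (\<pi>0, f \<pi>0 + e * (payoff u \<beta> z - snd y))"
      by (simp add: prod_eq_iff y_def z algebra_simps)
    finally have "f \<pi>0 + e * (payoff u \<beta> z - snd y) \<le> f \<pi>0"
      by (rule f(2)[OF \<pi>0])
    then have "payoff u \<beta> z \<le> snd y"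
      using e(1) by (simp add: mult_le_0_iff)
    then show ?thesis by (simp add: y_def)
  qed
  show thesis
  proof (rule that[OF I(1,3) \<alpha>(1,2) mean_fst])
    show "cav (u_bar u v) \<pi>0 \<le> (\<Sum>i\<in>I. c i * payoff u (\<alpha> i) (fst i))"
      using cav_le mean_snd \<alpha>(3) by simp
    show "(1 - t) * payoff u \<beta> (fst i) + t * payoff u \<beta> (fst j)
        \<le> (1 - t) * payoff u (\<alpha> i) (fst i) + t * payoff u (\<alpha> j) (fst j)"
      if "i \<in> I" "j \<in> I" "t \<in> {0..1}" "\<beta> \<in> BR v ((1 - t) *\<^sub>R fst i + t *\<^sub>R fst j)" for i j t \<beta>
      using no_gain[OF that(1-3) refl that(4)] that(1,2) \<alpha>(3)
      by (simp add: payoff_add_right payoff_scaleR_right)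
  qed
qed

section \<open>Almost all priors\<close>

text \<open>
  Here the experts gain at some belief in the region of \<open>a0\<close>, hence on its boundary. One
  signal, of small probability, leads to a belief slightly beyond that boundary; the other
  one, and any disagreement, leads to \<open>a0\<close>.
\<close>

lemma equilibrium_boundary:
  fixes u v :: "('a::finite, 'w::finite) payoff_fun"
  assumes rich1: "\<And>\<sigma> :: 'w stat_experiment. is_experiment \<sigma> \<Longrightarrow> \<exists>e :: 'w signal \<Rightarrow> 'm1. inj_on e \<sigma>"
    and rich2: "\<And>\<sigma> :: 'w stat_experiment. is_experiment \<sigma> \<Longrightarrow> \<exists>e :: 'w signal \<Rightarrow> 'm2. inj_on e \<sigma>"
    and \<pi>0: "\<pi>0 \<in> prob_vecs" "\<And>\<omega>. 0 < \<pi>0 $ \<omega>"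
    and a0: "\<And>a. a \<noteq> a0 \<Longrightarrow> payoff v (dirac a) \<pi>0 < payoff v (dirac a0) \<pi>0"
    and p: "p \<in> prob_vecs" "dirac a1 \<in> BR v p" "dirac a0 \<in> BR v p"
    and gain: "payoff u (dirac a0) p < payoff u (dirac a1) p"
    and q: "q \<in> prob_vecs" "dirac a1 \<in> BR v q" "payoff v (dirac a0) q < payoff v (dirac a1) q"
  shows "\<exists>E :: ('w, 'a, 'm1, 'm2) assessment.
    equilibrium u v \<pi>0 E \<and> eq_payoff v \<pi>0 E > payoff v (dirac a0) \<pi>0"
proof -
  let ?u = "\<lambda>a. payoff u (dirac a)" and ?v = "\<lambda>a. payoff v (dirac a)"
  \<comment> \<open>Moving from \<open>p\<close> towards \<open>q\<close> breaks the
    decision-maker's tie in favour of \<open>a1\<close>; a small \<epsilon> preserves the experts'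
    strict preference for \<open>a1\<close>.\<close>
  obtain \<epsilon> where \<epsilon>: "0 < \<epsilon>" "\<epsilon> < 1"
    "(?u a1 p - ?u a0 p) + \<epsilon> * ((?u a1 q - ?u a0 q) - (?u a1 p - ?u a0 p)) > 0"
    using ex_small_positive[of "{()}" "\<lambda>_. ?u a1 p - ?u a0 p"
        "\<lambda>_. (?u a1 q - ?u a0 q) - (?u a1 p - ?u a0 p)"] gain by auto
  define r where "r = (1 - \<epsilon>) *\<^sub>R p + \<epsilon> *\<^sub>R q"
  have payoff_r: "payoff x \<alpha> r = (1 - \<epsilon>) * payoff x \<alpha> p + \<epsilon> * payoff x \<alpha> q"
    for x :: "('a, 'w) payoff_fun" and \<alpha>
    by (simp add: r_def payoff_add_right payoff_scaleR_right)
  have r: "r \<in> prob_vecs"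
    unfolding r_def using \<epsilon> p(1) q(1) by (intro convexD[OF convex_prob_vecs]) auto
  have BR_r: "dirac a1 \<in> BR v r"
    unfolding BR_iff
  proof (intro conjI dirac_in_prob_vecs allI)
    fix a
    show "?v a r \<le> ?v a1 r"
      unfolding payoff_r using \<epsilon> p(2) q(2)
      by (intro add_mono mult_left_mono) (simp_all add: BR_iff)
  qed
  have u_r: "?u a0 r < ?u a1 r"
    using \<epsilon>(3) by (simp add: payoff_r algebra_simps)
  have v_r: "?v a0 r < ?v a1 r"
    unfolding payoff_r using \<epsilon> p(2) q(3)
    by (intro add_le_less_mono mult_left_mono mult_strict_left_mono) (simp_all add: BR_iff)
  \<comment> \<open>The \<open>Inl\<close> conditions make
    \<open>\<pi>0 - \<delta> *\<^sub>R r\<close> positive in every state. The \<open>Inr\<close>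
    conditions keep \<open>a0\<close> strictly better than every other action there.\<close>
  define A where "A x = (case x of Inl \<omega> \<Rightarrow> \<pi>0 $ \<omega> | Inr a \<Rightarrow> ?v a0 \<pi>0 - ?v a \<pi>0)" for x
  define A' where "A' x = (case x of Inl \<omega> \<Rightarrow> - r $ \<omega> | Inr a \<Rightarrow> ?v a r - ?v a0 r)" for x
  have "A x > 0" if "x \<in> range Inl \<union> Inr ` (- {a0})" for x
    using that by (elim UnE rangeE imageE) (simp_all add: A_def \<pi>0(2) a0)
  then obtain \<delta> where \<delta>: "0 < \<delta>" "\<delta> < 1"
    "\<And>x. x \<in> range Inl \<union> Inr ` (- {a0}) \<Longrightarrow> A x + \<delta> * A' x > 0"
    using ex_small_positive[of "range Inl \<union> Inr ` (- {a0})" A A'] by auto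
  \<comment> \<open>The posterior that balances \<open>r\<close>: the two average to the prior with
    weights \<delta> and \<open>1 - \<delta>\<close>.\<close>
  define z where "z = (1 / (1 - \<delta>)) *\<^sub>R (\<pi>0 - \<delta> *\<^sub>R r)"
  have mean: "\<delta> *\<^sub>R r + (1 - \<delta>) *\<^sub>R z = \<pi>0"
    using \<delta> by (simp add: z_def)
  have z: "z \<in> prob_vecs"
  proof -
    have "0 \<le> z $ \<omega>" for \<omega>
      using \<delta>(2) \<delta>(3)[of "Inl \<omega>"] by (simp add: z_def A_def A'_def)
    moreover have "(\<Sum>\<omega>\<in>UNIV. z $ \<omega>) = 1"
      using \<delta>(2) prob_vecs_sum[OF \<pi>0(1)] prob_vecs_sum[OF r]
      by (simp add: z_def sum_subtractf flip: sum_distrib_left sum_divide_distrib)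
    ultimately show ?thesis
      by (simp add: prob_vecs_def)
  qed
  have payoff_\<pi>0: "payoff x \<alpha> \<pi>0 = \<delta> * payoff x \<alpha> r + (1 - \<delta>) * payoff x \<alpha> z"
    for x :: "('a, 'w) payoff_fun" and \<alpha>
    unfolding mean[symmetric] by (simp add: payoff_add_right payoff_scaleR_right)
  have BR_z: "dirac a0 \<in> BR v z"
    unfolding BR_iff
  proof (intro conjI dirac_in_prob_vecs allI)
    fix a
    show "?v a z \<le> ?v a0 z"
    proof (cases "a = a0")
      case False
      then have "0 < ?v a0 \<pi>0 - ?v a \<pi>0 + \<delta> * (?v a r - ?v a0 r)"
        using \<delta>(3)[of "Inr a"] by (simp add: A_def A'_def)
      then have "(1 - \<delta>) * ?v a z \<le> (1 - \<delta>) * ?v a0 z"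
        unfolding payoff_\<pi>0 by (simp add: algebra_simps)
      then show ?thesis
        using \<delta>(2) by simp
    qed simp
  qed
  define w where "w i = (if i then \<delta> else 1 - \<delta>)" for i
  define b where "b i = (if i then r else z)" for i
  \<comment> \<open>Index \<open>True\<close> leads to \<open>r\<close>. A single report of
    \<open>False\<close> suffices for the belief \<open>z\<close> and hence for \<open>a0\<close>,
    which is the worse action for the experts at \<open>r\<close>.\<close>
  define B where "B i j = (if i \<and> j then r else z)" for i j
  define D where "D i j = (if i \<and> j then dirac a1 else dirac a0)" for i j
  have BR_\<pi>0: "dirac a0 \<in> BR v \<pi>0"
    unfolding BR_iff using a0 dirac_in_prob_vecs by (metis less_eq_real_def)
  have sum_D: "(\<Sum>i\<in>UNIV. w i * payoff x (D i i) (b i)) = \<delta> * payoff x (dirac a1) r + (1 - \<delta>) * payoff x (dirac a0) z"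
    for x :: "('a, 'w) payoff_fun"
    by (simp add: UNIV_bool w_def D_def b_def)
  have "\<exists>E :: ('w, 'a, 'm1, 'm2) assessment.
    equilibrium u v \<pi>0 E \<and> eq_payoff v \<pi>0 E = (\<Sum>i\<in>UNIV. w i * payoff v (D i i) (b i))"
  proof (rule cross_verification_equilibrium[where D = D and B = B and p = b, OF rich1 rich2 \<pi>0(1)])
    show "(\<Sum>i\<in>UNIV. w i *\<^sub>R b i) = \<pi>0"
      using mean by (simp add: UNIV_bool w_def b_def add.commute)
    show "B i j \<in> convex hull (range b)" for i j
      by (intro hull_inc) (auto simp: B_def b_def image_iff)
    show "D i j \<in> BR v (B i j)" for i j
      using BR_r BR_z by (simp add: D_def B_def)
    show "payoff u (D j i) (b i) \<le> payoff u (D i i) (b i)" for i j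
      using u_r by (simp add: D_def b_def)
    show "payoff u (D i j) (b i) \<le> payoff u (D i i) (b i)" for i j
      using u_r by (simp add: D_def b_def)
    \<comment> \<open>Compared with \<open>a0\<close> throughout, only the decision at
      \<open>r\<close> changes, and there \<open>a1\<close> is better for the experts.\<close>
    show "payoff u (dirac a0) \<pi>0 \<le> (\<Sum>i\<in>UNIV. w i * payoff u (D i i) (b i))"
      unfolding sum_D payoff_\<pi>0 using u_r \<delta>(1) by simp
  qed (use \<delta> r z BR_\<pi>0 in \<open>simp_all add: w_def b_def B_def\<close>)
  moreover have "?v a0 \<pi>0 < (\<Sum>i\<in>UNIV. w i * payoff v (D i i) (b i))"
    unfolding sum_D payoff_\<pi>0 using v_r \<delta>(1) by simp
  ultimately show ?thesis
    by metis
qed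

text \<open>
  If the experts gain nothing at any belief in the region of \<open>a0\<close>, an optimal splitting
  must leave that region, so its information is valuable to the decision-maker.
\<close>

lemma equilibrium_optimal_splitting:
  fixes u v :: "('a::finite, 'w::finite) payoff_fun"
  assumes rich1: "\<And>\<sigma> :: 'w stat_experiment. is_experiment \<sigma> \<Longrightarrow> \<exists>e :: 'w signal \<Rightarrow> 'm1. inj_on e \<sigma>"
    and rich2: "\<And>\<sigma> :: 'w stat_experiment. is_experiment \<sigma> \<Longrightarrow> \<exists>e :: 'w signal \<Rightarrow> 'm2. inj_on e \<sigma>"
    and \<pi>0: "\<pi>0 \<in> prob_vecs"
    and a0: "dirac a0 \<in> BR v \<pi>0"
    and no_gain: "\<And>p. p \<in> prob_vecs \<Longrightarrow> dirac a0 \<in> BR v p \<Longrightarrow> u_bar u v p \<le> payoff u (dirac a0) p"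
    and benefit: "u_bar u v \<pi>0 < cav (u_bar u v) \<pi>0"
  shows "\<exists>E :: ('w, 'a, 'm1, 'm2) assessment.
    equilibrium u v \<pi>0 E \<and> eq_payoff v \<pi>0 E > payoff v (dirac a0) \<pi>0"
proof -
  obtain I :: "((real ^ 'w) \<times> real) set" and w \<alpha> where
    I: "finite I" "\<And>i. i \<in> I \<Longrightarrow> 0 < w i" "\<And>i. i \<in> I \<Longrightarrow> fst i \<in> prob_vecs"
    and \<alpha>: "\<And>i. i \<in> I \<Longrightarrow> \<alpha> i \<in> BR v (fst i)" and mean: "(\<Sum>i\<in>I. w i *\<^sub>R fst i) = \<pi>0"
    and cav: "cav (u_bar u v) \<pi>0 \<le> (\<Sum>i\<in>I. w i * payoff u (\<alpha> i) (fst i))"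
    and opt: "\<And>i j t \<beta>. i \<in> I \<Longrightarrow> j \<in> I \<Longrightarrow> t \<in> {0..1} \<Longrightarrow> \<beta> \<in> BR v ((1 - t) *\<^sub>R fst i + t *\<^sub>R fst j) \<Longrightarrow>
      (1 - t) * payoff u \<beta> (fst i) + t * payoff u \<beta> (fst j)
        \<le> (1 - t) * payoff u (\<alpha> i) (fst i) + t * payoff u (\<alpha> j) (fst j)"
    by (rule ex_optimal_splitting[OF \<pi>0, of v u], rule that, assumption+)
  define u_I where "u_I i = payoff u (\<alpha> i) (fst i)" for i
  \<comment> \<open>The pairwise optimality of the splitting is the hypothesis of
    \<open>ex_punishment\<close>, with truthful payoffs as the two bounds.\<close>
  have "\<exists>t \<beta>. t \<in> {0..1} \<and> \<beta> \<in> BR v ((1 - t) *\<^sub>R fst i + t *\<^sub>R fst j)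
      \<and> payoff u \<beta> (fst i) \<le> u_I i \<and> payoff u \<beta> (fst j) \<le> u_I j"
    if "i \<in> I" "j \<in> I" for i j
    using ex_punishment[where c = "u_I i" and d = "u_I j" and u = u, OF opt[OF that, folded u_I_def]]
    by blast
  then have "\<forall>i j. \<exists>t \<beta>. i \<in> I \<and> j \<in> I \<longrightarrow> t \<in> {0..1} \<and>
      \<beta> \<in> BR v ((1 - t) *\<^sub>R fst i + t *\<^sub>R fst j) \<and>
      payoff u \<beta> (fst i) \<le> u_I i \<and> payoff u \<beta> (fst j) \<le> u_I j"
    by blast
  then obtain t \<beta> where punish: "\<And>i j. i \<in> I \<Longrightarrow> j \<in> I \<Longrightarrow> t i j \<in> {0..1}"
    "\<And>i j. i \<in> I \<Longrightarrow> j \<in> I \<Longrightarrow> \<beta> i j \<in> BR v ((1 - t i j) *\<^sub>R fst i + t i j *\<^sub>R fst j)"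
    "\<And>i j. i \<in> I \<Longrightarrow> j \<in> I \<Longrightarrow> payoff u (\<beta> i j) (fst i) \<le> u_I i"
    "\<And>i j. i \<in> I \<Longrightarrow> j \<in> I \<Longrightarrow> payoff u (\<beta> i j) (fst j) \<le> u_I j"
    unfolding choice_iff by blast
  \<comment> \<open>After reports \<open>i\<close> and \<open>j\<close> either expert may have lied,
    so \<open>\<beta> i j\<close> has to hold down both true types.\<close>
  define D where "D i j = (if i = j then \<alpha> i else \<beta> i j)" for i j
  define B where "B i j = (if i = j then fst i else (1 - t i j) *\<^sub>R fst i + t i j *\<^sub>R fst j)" for i j
  have D_diag: "D i i = \<alpha> i" for i
    by (simp add: D_def)
  have "\<exists>E :: ('w, 'a, 'm1, 'm2) assessment.
    equilibrium u v \<pi>0 E \<and> eq_payoff v \<pi>0 E = (\<Sum>i\<in>I. w i * payoff v (D i i) (fst i))"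
  proof (rule cross_verification_equilibrium[where D = D and B = B,
        OF rich1 rich2 \<pi>0 I(1,2,3) mean _ _ _ _ _ a0])
    fix i j assume ij: "i \<in> I" "j \<in> I"
    show "B i j \<in> convex hull (fst ` I)"
    proof (cases "i = j")
      case True
      then show ?thesis using ij by (simp add: B_def hull_inc)
    next
      case False
      have "(1 - t i j) *\<^sub>R fst i + t i j *\<^sub>R fst j \<in> convex hull (fst ` I)"
        using ij punish(1)[OF ij] by (intro convexD[OF convex_convex_hull] hull_inc) auto
      with False show ?thesis by (simp add: B_def)
    qed
    show "D i j \<in> BR v (B i j)"
      using \<alpha>[OF ij(2)] punish(2)[OF ij] by (simp add: D_def B_def)
    show "payoff u (D j i) (fst i) \<le> payoff u (D i i) (fst i)"
      using punish(4)[OF ij(2,1)] by (simp add: D_def u_I_def)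
    show "payoff u (D i j) (fst i) \<le> payoff u (D i i) (fst i)"
      using punish(3)[OF ij] by (simp add: D_def u_I_def)
  next
    show "payoff u (dirac a0) \<pi>0 \<le> (\<Sum>i\<in>I. w i * payoff u (D i i) (fst i))"
      using u_bar_ge[OF a0, of u] benefit cav by (simp add: D_diag)
  qed (simp_all add: B_def)
  moreover have "payoff v (dirac a0) \<pi>0 < (\<Sum>i\<in>I. w i * payoff v (\<alpha> i) (fst i))"
  proof -
    have sum_\<pi>0: "payoff x (dirac a0) \<pi>0 = (\<Sum>i\<in>I. w i * payoff x (dirac a0) (fst i))"
      for x :: "('a, 'w) payoff_fun"
      unfolding mean[symmetric] by (rule payoff_sum_right)
    \<comment> \<open>If \<open>a0\<close> were optimal at every posterior, \<open>no_gain\<close>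
      would let \<open>a0\<close> match the payoffs of the splitting. By linearity their mean would
      then be at most the payoff of \<open>a0\<close> at \<pi>0, contradicting
      \<open>benefit\<close>.\<close>
    have "\<exists>i\<in>I. dirac a0 \<notin> BR v (fst i)"
    proof (rule ccontr)
      assume "\<not> (\<exists>i\<in>I. dirac a0 \<notin> BR v (fst i))"
      then have BR: "dirac a0 \<in> BR v (fst i)" if "i \<in> I" for i
        using that by blast
      have "payoff u (\<alpha> i) (fst i) \<le> payoff u (dirac a0) (fst i)" if "i \<in> I" for i
        using u_bar_ge[OF \<alpha>[OF that], of u] no_gain[OF I(3)[OF that] BR[OF that]] by simp
      then have "(\<Sum>i\<in>I. w i * payoff u (\<alpha> i) (fst i)) \<le> payoff u (dirac a0) \<pi>0"
        unfolding sum_\<pi>0 using I(2) by (intro sum_mono mult_left_mono) (simp_all add: less_imp_le)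
      then show False
        using u_bar_ge[OF a0, of u] benefit cav by simp
    qed
    then obtain i where i: "i \<in> I" "dirac a0 \<notin> BR v (fst i)" by blast
    have le: "payoff v (dirac a0) (fst j) \<le> payoff v (\<alpha> j) (fst j)" if "j \<in> I" for j
      using \<alpha>[OF that] by (simp add: BR_iff)
    have "payoff v (dirac a0) (fst i) < payoff v (\<alpha> i) (fst i)"
    proof (rule ccontr)
      assume "\<not> ?thesis"
      then have "payoff v (\<alpha> i) (fst i) \<le> payoff v (dirac a0) (fst i)" by simp
      then have "dirac a0 \<in> BR v (fst i)"
        using \<alpha>[OF i(1)] dirac_in_prob_vecs unfolding BR_iff by (meson order_trans)
      with i(2) show False by blast
    qed
    then show ?thesis
      unfolding sum_\<pi>0 using I i(1) le
      by (intro sum_strict_mono_ex1 ballI bexI[of _ i] mult_left_mono mult_strict_left_mono)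
        (simp_all add: less_imp_le)
  qed
  ultimately show ?thesis
    unfolding D_diag by metis
qed

section \<open>The exceptional priors and the two cases\<close>

theorem proposition1:
  fixes u v :: "('a::finite, 'w::finite) payoff_fun"
  assumes nonredundant: "no_redundant_actions v"
    and rich1: "\<And>\<sigma> :: 'w stat_experiment. is_experiment \<sigma> \<Longrightarrow> \<exists>e :: 'w signal \<Rightarrow> 'm1. inj_on e \<sigma>"
    and rich2: "\<And>\<sigma> :: 'w stat_experiment. is_experiment \<sigma> \<Longrightarrow> \<exists>e :: 'w signal \<Rightarrow> 'm2. inj_on e \<sigma>"
  shows "for_almost_all_priors (\<lambda>\<pi>0.
           cav (u_bar u v) \<pi>0 > u_bar u v \<pi>0 \<longrightarrow>
           (\<exists>E :: ('w, 'a, 'm1, 'm2) assessment.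
              equilibrium u v \<pi>0 E \<and>
              eq_payoff v \<pi>0 E > Max (range (\<lambda>a. payoff v (dirac a) \<pi>0))))"
proof -
  let ?R = "rationalizable_actions v"
  \<comment> \<open>Normals of the excluded hyperplanes: the coordinate functionals exclude
    non-interior priors, the payoff differences exclude ties between rationalizable actions.\<close>
  let ?L = "range (\<lambda>\<omega>0 \<omega>. if \<omega> = \<omega>0 then 1 else 0)
    \<union> (\<lambda>(a, b) \<omega>. v a \<omega> - v b \<omega>) ` {(a, b) \<in> ?R \<times> ?R. a \<noteq> b}"
  have payoff_dirac: "payoff v (dirac a) \<pi> = (\<Sum>\<omega>\<in>UNIV. v a \<omega> * \<pi> $ \<omega>)" for a \<pi>
    by (simp add: payoff_def axis_def if_distrib if_distribR sum.swap[of _ "UNIV :: 'w set"]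
        mult.commute cong: if_cong)
  have "simplex_null {\<pi> \<in> prob_vecs. (\<Sum>\<omega>\<in>UNIV. l \<omega> * \<pi> $ \<omega>) = 0}" if l: "l \<in> ?L" for l
  proof (rule simplex_null_hyperplane)
    show "\<exists>\<omega>. l \<omega> \<noteq> 0"
    proof (rule ccontr)
      assume "\<nexists>\<omega>. l \<omega> \<noteq> 0"
      then have l_0: "l \<omega> = 0" for \<omega> by blast
      from l show False
      proof (elim UnE rangeE imageE)
        fix \<omega>0 assume "l = (\<lambda>\<omega>. if \<omega> = \<omega>0 then 1 else 0)"
        with l_0[of \<omega>0] show False by simp
      next
        fix x assume x: "l = (case x of (a, b) \<Rightarrow> \<lambda>\<omega>. v a \<omega> - v b \<omega>)"
          "x \<in> {(a, b) \<in> ?R \<times> ?R. a \<noteq> b}"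
        obtain a b where "x = (a, b)" by (cases x)
        with x have ab: "l = (\<lambda>\<omega>. v a \<omega> - v b \<omega>)" "a \<in> ?R" "b \<in> ?R" "a \<noteq> b"
          by simp_all
        \<comment> \<open>Non-redundancy separates the two actions at some belief, so their payoff
          difference is not the zero functional.\<close>
        obtain \<pi> where "payoff v (dirac b) \<pi> < payoff v (dirac a) \<pi>"
          using ex_separating_belief[OF nonredundant ab(2,3,4)] by blast
        moreover have "v a = v b"
          using l_0 unfolding ab(1) by (intro ext) simp
        ultimately show False
          by (simp add: payoff_dirac)
      qed
    qed
  qed
  then have "simplex_null (\<Union>l\<in>?L. {\<pi> \<in> prob_vecs. (\<Sum>\<omega>\<in>UNIV. l \<omega> * \<pi> $ \<omega>) = 0})"
    by (intro simplex_null_UN) simp_all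
  then show ?thesis
    unfolding for_almost_all_priors_def
  proof (rule simplex_null_subset, intro subsetI)
    fix \<pi>0 :: "real ^ 'w"
    assume "\<pi>0 \<in> {\<pi> \<in> prob_vecs. \<not> (cav (u_bar u v) \<pi> > u_bar u v \<pi> \<longrightarrow>
      (\<exists>E :: ('w, 'a, 'm1, 'm2) assessment. equilibrium u v \<pi> E \<and>
        eq_payoff v \<pi> E > Max (range (\<lambda>a. payoff v (dirac a) \<pi>))))}"
    then have \<pi>0: "\<pi>0 \<in> prob_vecs" and benefit: "u_bar u v \<pi>0 < cav (u_bar u v) \<pi>0"
      and no_eq: "\<nexists>E :: ('w, 'a, 'm1, 'm2) assessment. equilibrium u v \<pi>0 E \<and>
        eq_payoff v \<pi>0 E > Max (range (\<lambda>a. payoff v (dirac a) \<pi>0))"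
      by blast+
    show "\<pi>0 \<in> (\<Union>l\<in>?L. {\<pi> \<in> prob_vecs. (\<Sum>\<omega>\<in>UNIV. l \<omega> * \<pi> $ \<omega>) = 0})"
    proof (rule ccontr)
      assume "\<pi>0 \<notin> (\<Union>l\<in>?L. {\<pi> \<in> prob_vecs. (\<Sum>\<omega>\<in>UNIV. l \<omega> * \<pi> $ \<omega>) = 0})"
      then have generic: "(\<Sum>\<omega>\<in>UNIV. l \<omega> * \<pi>0 $ \<omega>) \<noteq> 0" if "l \<in> ?L" for l
        using \<pi>0 that by blast
      have pos: "0 < \<pi>0 $ \<omega>" for \<omega>
      proof -
        have "(if \<omega>' = \<omega> then 1 else 0) * x = (if \<omega>' = \<omega> then x else 0)" for \<omega>' and x :: real
          by simp
        then have "\<pi>0 $ \<omega> \<noteq> 0"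
          using generic[of "\<lambda>\<omega>'. if \<omega>' = \<omega> then 1 else 0"] by simp
        then show ?thesis
          using prob_vecs_nonneg[OF \<pi>0, of \<omega>] by simp
      qed
      obtain a0 where a0: "dirac a0 \<in> BR v \<pi>0"
        using ex_dirac_BR by blast
      then have a0_R: "a0 \<in> ?R"
        using \<pi>0 unfolding rationalizable_actions_def by blast
      \<comment> \<open>An action that ties with \<open>a0\<close> at \<pi>0 would be a best reply
        there, hence rationalizable, and \<pi>0 would lie on one of the excluded
        hyperplanes.\<close>
      have strict: "payoff v (dirac a) \<pi>0 < payoff v (dirac a0) \<pi>0" if "a \<noteq> a0" for a
      proof -
        have le: "payoff v (dirac b) \<pi>0 \<le> payoff v (dirac a0) \<pi>0" for b
          using a0 by (simp add: BR_iff)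
        have "payoff v (dirac a) \<pi>0 \<noteq> payoff v (dirac a0) \<pi>0"
        proof
          assume eq: "payoff v (dirac a) \<pi>0 = payoff v (dirac a0) \<pi>0"
          then have "dirac a \<in> BR v \<pi>0"
            using le dirac_in_prob_vecs by (simp add: BR_iff)
          then have "a \<in> ?R"
            using \<pi>0 unfolding rationalizable_actions_def by blast
          then have "(\<Sum>\<omega>\<in>UNIV. (v a \<omega> - v a0 \<omega>) * \<pi>0 $ \<omega>) \<noteq> 0"
            using that a0_R by (intro generic UnI2 image_eqI[of _ _ "(a, a0)"]) simp_all
          with eq show False
            by (simp add: payoff_dirac left_diff_distrib sum_subtractf)
        qed
        with le[of a] show ?thesis by simp
      qed
      have Max_eq: "Max (range (\<lambda>a. payoff v (dirac a) \<pi>0)) = payoff v (dirac a0) \<pi>0"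
        using a0 by (intro Max_eqI) (auto simp: BR_iff)
      have "\<exists>E :: ('w, 'a, 'm1, 'm2) assessment.
        equilibrium u v \<pi>0 E \<and> eq_payoff v \<pi>0 E > payoff v (dirac a0) \<pi>0"
      \<comment> \<open>The cases differ in whether the experts can gain over \<open>a0\<close> at
        some belief at which \<open>a0\<close> is still optimal. If so, \<open>a0\<close> and a
        better action \<open>a1\<close> tie for the decision-maker at that belief, and
        non-redundancy gives a belief where \<open>a1\<close> wins strictly.\<close>
      proof (cases "\<exists>p\<in>prob_vecs. dirac a0 \<in> BR v p \<and> payoff u (dirac a0) p < u_bar u v p")
        case True
        then obtain p where p: "p \<in> prob_vecs" "dirac a0 \<in> BR v p" "payoff u (dirac a0) p < u_bar u v p"
          by blast
        obtain a1 where a1: "dirac a1 \<in> BR v p" "u_bar u v p = payoff u (dirac a1) p"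
          using u_bar_attained_dirac by blast
        have "a1 \<in> ?R"
          using a1(1) p(1) unfolding rationalizable_actions_def by blast
        moreover have "a1 \<noteq> a0"
          using p(3) a1(2) by auto
        ultimately obtain q where q: "q \<in> prob_vecs" "dirac a1 \<in> BR v q"
          "payoff v (dirac a0) q < payoff v (dirac a1) q"
          using ex_separating_belief[OF nonredundant _ a0_R] by blast
        have gain: "payoff u (dirac a0) p < payoff u (dirac a1) p"
          using p(3) unfolding a1(2) .
        show ?thesis
          by (rule equilibrium_boundary[OF rich1 rich2 \<pi>0 pos strict p(1) a1(1) p(2) gain q])
      next
        case False
        then show ?thesis
          by (intro equilibrium_optimal_splitting[OF rich1 rich2 \<pi>0 a0 _ benefit]) (auto simp: not_less)
      qed
      with no_eq show False
        unfolding Max_eq by blast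
    qed
  qed
qed

end
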